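(* Let $\mathcal{H}_1,\mathcal{H}_2$ be complex separable Hilbert spaces, let $A:\operatorname{dom}(A)\subseteq\mathcal{H}_1\to\mathcal{H}_2$ be a densely defined, closed, linear operator with $A^*A\geq\varepsilon I_{\mathcal{H}_1}$ for some $\varepsilon>0$, and let $R$ be a densely defined, closable operator in $\mathcal{H}_1$ with $\operatorname{dom}(R)\supseteq\operatorname{dom}(A)$. Then $$Q_{|A|,R}=U_{\widetilde{|A|}}\,i\,G_{A,R}\,U_{\widetilde{|A|}}^{-1}$$ (equality including domains). In particular, the operator $G_{A,R}$ is densely defined and closed in $\mathcal{H}_A\oplus\mathcal{H}_1$. If in addition $R$ is accretive, then also $-G_{A,R}$ is accretive and $G_{A,R}$ generates a (strongly continuous) contraction semigroup $\exp(G_{A,R}\,t)$, $t\geq0$, in $\mathcal{H}_A\oplus\mathcal{H}_1$.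
   Context: $|A|=(A^*A)^{1/2}$, with $\operatorname{dom}(|A|)=\operatorname{dom}(A)$ and $\||A|f\|_{\mathcal{H}_1}=\|Af\|_{\mathcal{H}_2}$. Under the hypothesis $A^*A\ge\varepsilon I_{\mathcal{H}_1}$: - $\mathcal{H}_A$ is the Hilbert space $\operatorname{dom}(A)$ with scalar product $(f,g)_A=(Af,Ag)_{\mathcal{H}_2}$. - $\widetilde A:\mathcal{H}_A\to\mathcal{K}_A=\operatorname{ran}(A)$, $f\mapsto Af$, and $\widetilde{|A|}:\mathcal{H}_A\to\mathcal{H}_1$, $f\mapsto|A|f$; both are unitary ($\operatorname{ran}(A)$ is closed in $\mathcal{H}_2$). - $J_A:\mathcal{H}_1\supseteq\operatorname{dom}(A)\to\mathcal{H}_A$, $f\mapsto f$. - $U_{\widetilde{|A|}}=\begin{pmatrix}0&I_{\mathcal{H}_1}\\-i\widetilde{|A|}&0\end{pmatrix}:\mathcal{H}_A\oplus\mathcal{H}_1\to\mathcal{H}_1\oplus\mathcal{H}_1$, a unitary operator. - $G_{A,R}=\begin{pmatrix}0&J_A\\-A^*\widetilde A&-R\end{pmatrix}$ in $\mathcal{H}_A\oplus\mathcal{H}_1$ with $\operatorname{dom}(G_{A,R})=\operatorname{dom}(A^*\widetilde A)\oplus\operatorname{dom}(A)$, where $\operatorname{dom}(A^*\widetilde A)=\{f\in\mathcal{H}_A:\widetilde Af\in\operatorname{dom}(A^* )\}$. - $Q_{|A|,R}=\begin{pmatrix}-iR&|A|\\|A|&0\end{pmatrix}$ in $\mathcal{H}_1\oplus\mathcal{H}_1$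 with $\operatorname{dom}(Q_{|A|,R})=\operatorname{dom}(|A|)\oplus\operatorname{dom}(|A|)$. An operator $T$ in a Hilbert space $\mathcal{H}$ is accretive if $\operatorname{Re}((f,Tf)_{\mathcal{H}})\geq0$ for all $f\in\operatorname{dom}(T)$. *)

theory Defs
  imports "HOL-Analysis.Analysis"
begin

section \<open>Complex Hilbert spaces\<close>

class complex_vector = real_vector +
  fixes scaleC :: "complex \<Rightarrow> 'a \<Rightarrow> 'a"  (infixr "*\<^sub>C" 75)
  assumes scaleC_add_right: "c *\<^sub>C (x + y) = c *\<^sub>C x + c *\<^sub>C y"
    and scaleC_add_left: "(c + d) *\<^sub>C x = c *\<^sub>C x + d *\<^sub>C x"
    and scaleC_scaleC: "c *\<^sub>C (d *\<^sub>C x) = (c * d) *\<^sub>C x"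
    and scaleR_scaleC: "r *\<^sub>R x = complex_of_real r *\<^sub>C x"

text \<open>The scalar product is linear in the second and conjugate-linear in the first argument.
  Its positive definiteness is part of \<open>cinner_self\<close>.\<close>

class complex_inner = complex_vector + real_normed_vector +
  fixes cinner :: "'a \<Rightarrow> 'a \<Rightarrow> complex"
  assumes cinner_commute: "cinner x y = cnj (cinner y x)"
    and cinner_add_right: "cinner x (y + z) = cinner x y + cinner x z"
    and cinner_scaleC_right: "cinner x (c *\<^sub>C y) = c * cinner x y"
    and cinner_self: "cinner x x = complex_of_real ((norm x)\<^sup>2)"

class chilbert_space = complex_inner + complete_space

instantiation prod :: (complex_vector, complex_vector) complex_vector
begin

definition scaleC_prod_def: "c *\<^sub>C p = (c *\<^sub>C fst p, c *\<^sub>C snd p)"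

instance
  by standard
    (simp_all add: scaleC_prod_def prod_eq_iff scaleC_add_right scaleC_add_left
      scaleC_scaleC scaleR_scaleC)

end

abbreviation csubspace :: "'a::complex_vector set \<Rightarrow> bool"
  where "csubspace \<equiv> module.subspace scaleC"

text \<open>A Hilbert space such as \<open>dom A\<close> with its own scalar product is not a type.  It is
  represented by its underlying linear subspace of a type together with its scalar product;
  \<open>univ_space\<close> is the Hilbert space formed by a whole type.\<close>

record 'a inner_space =
  hcarrier :: "'a set"
  hinner :: "'a \<Rightarrow> 'a \<Rightarrow> complex"

definition univ_space :: "'a::complex_inner inner_space"
  where "univ_space = \<lparr>hcarrier = UNIV, hinner = cinner\<rparr>"

definition sum_space :: "'a inner_space \<Rightarrow> 'b inner_space \<Rightarrow> ('a \<times> 'b) inner_space"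
    (infixr "\<oplus>\<^sub>h" 65)
  where "H \<oplus>\<^sub>h K = \<lparr>hcarrier = hcarrier H \<times> hcarrier K,
    hinner = (\<lambda>(f, g) (f', g'). hinner H f f' + hinner K g g')\<rparr>"

definition hnorm :: "'a inner_space \<Rightarrow> 'a \<Rightarrow> real"
  where "hnorm H x = sqrt (Re (hinner H x x))"

definition htop :: "'a::complex_vector inner_space \<Rightarrow> 'a topology"
  where "htop H = Metric_space.mtopology (hcarrier H) (\<lambda>x y. hnorm H (x - y))"

lemma hnorm_univ_space: "hnorm univ_space x = norm x"
  by (simp add: hnorm_def univ_space_def cinner_self)

lemma htop_univ_space: "htop univ_space = euclidean"
proof -
  have "(\<lambda>x y. hnorm univ_space (x - y)) = (dist :: 'a::complex_inner \<Rightarrow> _)"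
    by (simp add: hnorm_univ_space dist_norm fun_eq_iff)
  then show ?thesis
    by (simp add: htop_def) (simp add: univ_space_def)
qed


section \<open>Unbounded operators, identified with their graphs\<close>

type_synonym ('a, 'b) graph = "('a \<times> 'b) set"

definition linear_op ::
    "'a::complex_vector inner_space \<Rightarrow> 'b::complex_vector inner_space \<Rightarrow> ('a, 'b) graph \<Rightarrow> bool"
  where "linear_op H K T \<longleftrightarrow>
    T \<subseteq> hcarrier H \<times> hcarrier K \<and> csubspace T \<and> single_valued T"

definition densely_defined :: "'a::complex_vector inner_space \<Rightarrow> ('a, 'b) graph \<Rightarrow> bool"
  where "densely_defined H T \<longleftrightarrow> htop H closure_of (Domain T) = hcarrier H"

definition closed_op ::
    "'a::complex_vector inner_space \<Rightarrow> 'b::complex_vector inner_space \<Rightarrow> ('a, 'b) graph \<Rightarrow> bool"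
  where "closed_op H K T \<longleftrightarrow>
    linear_op H K T \<and> closedin (prod_topology (htop H) (htop K)) T"

definition closable_op ::
    "'a::complex_vector inner_space \<Rightarrow> 'b::complex_vector inner_space \<Rightarrow> ('a, 'b) graph \<Rightarrow> bool"
  where "closable_op H K T \<longleftrightarrow> linear_op H K T \<and> (\<exists>S. closed_op H K S \<and> T \<subseteq> S)"

definition app :: "('a, 'b) graph \<Rightarrow> 'a \<Rightarrow> 'b"
  where "app T x = (THE y. (x, y) \<in> T)"

definition mk_op :: "'a set \<Rightarrow> ('a \<Rightarrow> 'b) \<Rightarrow> ('a, 'b) graph"
  where "mk_op D F = {(x, F x) | x. x \<in> D}"

text \<open>Composition is taken on the natural domain; in \<open>S \<odot> T\<close> the operator \<open>T\<close> acts first.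
  The inverse of an operator is the converse \<open>T\<inverse>\<close> of its graph.\<close>

definition op_comp :: "('b, 'c) graph \<Rightarrow> ('a, 'b) graph \<Rightarrow> ('a, 'c) graph"  (infixr "\<odot>" 75)
  where "S \<odot> T = T O S"

definition op_scale :: "complex \<Rightarrow> ('a, 'b::complex_vector) graph \<Rightarrow> ('a, 'b) graph"
  where "op_scale c T = {(x, c *\<^sub>C y) | x y. (x, y) \<in> T}"

definition adjoint_op ::
    "('a::complex_inner, 'b::complex_inner) graph \<Rightarrow> ('b, 'a) graph"
  where "adjoint_op T = {(g, h). \<forall>(f, y) \<in> T. cinner g y = cinner h f}"

definition self_adjoint :: "('a::complex_inner, 'a) graph \<Rightarrow> bool"
  where "self_adjoint T \<longleftrightarrow>
    linear_op univ_space univ_space T \<and> densely_defined univ_space T \<and> adjoint_op T = T"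

text \<open>\<open>T \<ge> c I\<close> in the sense of quadratic forms.  It is used for symmetric \<open>T\<close> only, for which
  \<open>cinner f (T f)\<close> is real.\<close>

definition op_geq :: "('a::complex_inner, 'a) graph \<Rightarrow> real \<Rightarrow> bool"
  where "op_geq T c \<longleftrightarrow> (\<forall>(f, h) \<in> T. Re (cinner f h) \<ge> c * (norm f)\<^sup>2)"

text \<open>The square root of a nonnegative self-adjoint operator is its unique nonnegative
  self-adjoint square root.\<close>

definition op_sqrt :: "('a::complex_inner, 'a) graph \<Rightarrow> ('a, 'a) graph"
  where "op_sqrt T = (THE B. self_adjoint B \<and> op_geq B 0 \<and> B \<odot> B = T)"

definition op_abs :: "('a::complex_inner, 'b::complex_inner) graph \<Rightarrow> ('a, 'a) graph"
  where "op_abs A = op_sqrt (adjoint_op A \<odot> A)"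

definition accretive :: "'a inner_space \<Rightarrow> ('a, 'a) graph \<Rightarrow> bool"
  where "accretive H T \<longleftrightarrow> (\<forall>(f, y) \<in> T. Re (hinner H f y) \<ge> 0)"


section \<open>Contraction semigroups\<close>

definition contraction_semigroup ::
    "'a::complex_vector inner_space \<Rightarrow> (real \<Rightarrow> 'a \<Rightarrow> 'a) \<Rightarrow> bool"
  where "contraction_semigroup H S \<longleftrightarrow>
    (\<forall>t\<ge>0. S t \<in> hcarrier H \<rightarrow> hcarrier H) \<and>
    (\<forall>t\<ge>0. \<forall>x\<in>hcarrier H. \<forall>y\<in>hcarrier H. S t (x + y) = S t x + S t y) \<and>
    (\<forall>t\<ge>0. \<forall>c. \<forall>x\<in>hcarrier H. S t (c *\<^sub>C x) = c *\<^sub>C S t x) \<and>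
    (\<forall>x\<in>hcarrier H. S 0 x = x) \<and>
    (\<forall>s\<ge>0. \<forall>t\<ge>0. \<forall>x\<in>hcarrier H. S (s + t) x = S s (S t x)) \<and>
    (\<forall>t\<ge>0. \<forall>x\<in>hcarrier H. hnorm H (S t x) \<le> hnorm H x) \<and>
    (\<forall>x\<in>hcarrier H. continuous_map (top_of_set {0..}) (htop H) (\<lambda>t. S t x))"

definition generator ::
    "'a::complex_vector inner_space \<Rightarrow> (real \<Rightarrow> 'a \<Rightarrow> 'a) \<Rightarrow> ('a, 'a) graph"
  where "generator H S = {(x, y). x \<in> hcarrier H \<and>
    limitin (htop H) (\<lambda>t. (1 / t) *\<^sub>R (S t x - x)) y (at_right 0)}"

definition generates_contraction_semigroup ::
    "'a::complex_vector inner_space \<Rightarrow> ('a, 'a) graph \<Rightarrow> bool"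
  where "generates_contraction_semigroup H G \<longleftrightarrow>
    (\<exists>S. contraction_semigroup H S \<and> generator H S = G)"


section \<open>The operator matrices\<close>

definition H_of :: "('a::complex_inner, 'b::complex_inner) graph \<Rightarrow> 'a inner_space"
  where "H_of A = \<lparr>hcarrier = Domain A, hinner = (\<lambda>f g. cinner (app A f) (app A g))\<rparr>"

text \<open>The following three operators have domain \<open>dom A\<close>.  In the first two it is the whole of
  \<open>H_of A\<close>; in the third it is a subspace of the first Hilbert space, with values in \<open>H_of A\<close>.\<close>

definition tilde_op :: "('a::complex_inner, 'b::complex_inner) graph \<Rightarrow> ('a, 'b) graph"
  where "tilde_op A = mk_op (hcarrier (H_of A)) (app A)"

definition tilde_abs :: "('a::complex_inner, 'b::complex_inner) graph \<Rightarrow> ('a, 'a) graph"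
  where "tilde_abs A = mk_op (hcarrier (H_of A)) (app (op_abs A))"

definition J_op :: "('a::complex_inner, 'b::complex_inner) graph \<Rightarrow> ('a, 'a) graph"
  where "J_op A = mk_op (Domain A) (\<lambda>f. f)"

definition U_op ::
    "('a::complex_inner, 'b::complex_inner) graph \<Rightarrow> ('a \<times> 'a, 'a \<times> 'a) graph"
  where "U_op A = mk_op (hcarrier (H_of A \<oplus>\<^sub>h univ_space))
    (\<lambda>(f, g). (g, (- \<i>) *\<^sub>C app (tilde_abs A) f))"

definition G_op ::
    "('a::complex_inner, 'b::complex_inner) graph \<Rightarrow> ('a, 'a) graph \<Rightarrow> ('a \<times> 'a, 'a \<times> 'a) graph"
  where "G_op A R = mk_op (Domain (adjoint_op A \<odot> tilde_op A) \<times> Domain A)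
    (\<lambda>(f, g). (app (J_op A) g, - app (adjoint_op A \<odot> tilde_op A) f - app R g))"

definition Q_op :: "('a::complex_inner, 'a) graph \<Rightarrow> ('a, 'a) graph \<Rightarrow> ('a \<times> 'a, 'a \<times> 'a) graph"
  where "Q_op B R = mk_op (Domain B \<times> Domain B)
    (\<lambda>(f, g). ((- \<i>) *\<^sub>C app R f + app B g, app B f))"

end

theory Submission
  imports Defs
begin

text \<open>Since \<open>A\<^sup>*A \<ge> \<epsilon>\<close>, the operator \<open>A\<^sup>*A\<close> has a bounded positive inverse \<open>K\<close>, and \<open>|A|\<close> is the
  inverse of the bounded positive square root \<open>C\<close> of \<open>K\<close>.  The operator \<open>A C\<close> is isometric, and
  decomposing \<open>A f\<close> along its range gives \<open>dom A = ran C\<close>.  Conjugating \<open>G\<close> by \<open>U\<close> leads to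
  \<open>N = - \<i> Q\<close> on \<open>H\<^sub>1 \<oplus> H\<^sub>1\<close>, which involves only \<open>C\<close> and \<open>R C\<close>; the latter is bounded by the closed
  graph theorem, so \<open>N\<close> is closed.  If \<open>R\<close> is accretive, then \<open>N\<close> is dissipative, \<open>\<mu> - N\<close> is onto for
  small \<open>\<mu> > 0\<close>, hence for all \<open>\<mu> > 0\<close>, and the implicit Euler scheme \<open>(1 - hN)\<^sup>-\<^sup>1\<close> with dyadic steps
  converges to a contraction semigroup generated by \<open>N\<close>.\<close>

section \<open>Complex inner product spaces\<close>

text \<open>No spectral theorem is used. \<open>op_abs\<close> is a definite description over
  possibly unbounded operators, so the root is built on the bounded side and inverted; a competing
  root of A*A is shown to have a bounded inverse with square K, which makes it comparable with C.
  The delicate point is dom A = ran C, because C is made from A*A alone, whose domain is ran K.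
  Closedness of A carries the isometry from ran K to ran C. H_A is not a type, so its topology is
  only a term. The analysis is therefore done for N on a product type and transported back along the
  unitary map. The range condition for small mu rests on boundedness of C and R C alone: at mu = 0
  the system is solved explicitly, and small mu is a perturbation. Dissipativity supplies the
  resolvent bound 1 / mu that carries solvability to every mu > 0. With dyadic steps a refinement
  replaces each step by exactly two halves. On the domain of the square of N the error per
  refinement is of the order of the step length, hence summable; density and contractivity do the
  rest.\<close>

lemma scaleC_one [simp]: "1 *\<^sub>C x = (x :: 'a::complex_vector)"
  using scaleR_scaleC[of 1 x] by simp

lemma module_scaleC: "module (scaleC :: complex \<Rightarrow> 'a::complex_vector \<Rightarrow> 'a)"
  by standard (simp_all add: scaleC_add_right scaleC_add_left scaleC_scaleC)

lemma scaleC_zero_left [simp]: "0 *\<^sub>C x = (0 :: 'a::complex_vector)"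
  and scaleC_zero_right [simp]: "c *\<^sub>C 0 = (0 :: 'a::complex_vector)"
  and scaleC_minus_left [simp]: "(- c) *\<^sub>C x = - (c *\<^sub>C x)"
  and scaleC_minus_right [simp]: "c *\<^sub>C (- x) = - (c *\<^sub>C x)"
  and scaleC_diff_right: "c *\<^sub>C (x - y) = c *\<^sub>C x - c *\<^sub>C (y :: 'a::complex_vector)"
  by (simp_all add: module.scale_zero_left[OF module_scaleC] module.scale_zero_right[OF module_scaleC]
      module.scale_minus_left[OF module_scaleC] module.scale_minus_right[OF module_scaleC]
      module.scale_right_diff_distrib[OF module_scaleC])

lemma scaleC_scaleR_commute: "c *\<^sub>C (r *\<^sub>R x) = r *\<^sub>R (c *\<^sub>C (x :: 'a::complex_vector))"
  by (simp add: scaleR_scaleC scaleC_scaleC mult.commute)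

lemma csubspace_iff:
  "csubspace S \<longleftrightarrow> 0 \<in> S \<and> (\<forall>x\<in>S. \<forall>y\<in>S. x + y \<in> S) \<and> (\<forall>c. \<forall>x\<in>S. c *\<^sub>C x \<in> S)"
  by (rule module.subspace_def[OF module_scaleC])

lemma
  assumes "csubspace S"
  shows csubspace_0: "0 \<in> S"
    and csubspace_add: "x \<in> S \<Longrightarrow> y \<in> S \<Longrightarrow> x + y \<in> S"
    and csubspace_scaleC: "x \<in> S \<Longrightarrow> c *\<^sub>C x \<in> S"
    and csubspace_scaleR: "x \<in> S \<Longrightarrow> r *\<^sub>R x \<in> S"
    and csubspace_diff: "x \<in> S \<Longrightarrow> y \<in> S \<Longrightarrow> x - y \<in> S"
  using assms
  by (simp_all add: csubspace_iff scaleR_scaleC module.subspace_diff[OF module_scaleC])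

lemma cinner_add_left: "cinner (x + y) z = cinner x z + cinner y (z :: 'a::complex_inner)"
  by (metis cinner_commute cinner_add_right complex_cnj_add)

lemma cinner_scaleC_left: "cinner (c *\<^sub>C x) y = cnj c * cinner x (y :: 'a::complex_inner)"
  by (metis cinner_commute cinner_scaleC_right complex_cnj_mult)

lemma cinner_scaleR_right: "cinner x (r *\<^sub>R y) = r *\<^sub>R cinner x (y :: 'a::complex_inner)"
  by (simp add: scaleR_scaleC cinner_scaleC_right scaleR_conv_of_real)

lemma cinner_scaleR_left: "cinner (r *\<^sub>R x) y = r *\<^sub>R cinner x (y :: 'a::complex_inner)"
  by (simp add: scaleR_scaleC cinner_scaleC_left scaleR_conv_of_real)

lemma norm_add_sqr:
  "(norm (x + y))\<^sup>2 = (norm x)\<^sup>2 + 2 * Re (cinner x y) + (norm (y :: 'a::complex_inner))\<^sup>2"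
proof -
  have "complex_of_real ((norm (x + y))\<^sup>2)
      = cinner x x + cinner x y + cnj (cinner x y) + cinner y y"
    unfolding cinner_self[symmetric] cinner_commute[of x y, symmetric] cinner_commute[of y x, symmetric]
    by (simp add: cinner_add_left cinner_add_right)
  then have "Re (complex_of_real ((norm (x + y))\<^sup>2))
      = Re (cinner x x + cinner x y + cnj (cinner x y) + cinner y y)"
    by simp
  then show ?thesis
    by (simp add: cinner_self del: of_real_power)
qed

lemma norm_scaleC: "norm (c *\<^sub>C x) = cmod c * norm (x :: 'a::complex_inner)"
proof -
  have "complex_of_real ((norm (c *\<^sub>C x))\<^sup>2) = complex_of_real ((cmod c * norm x)\<^sup>2)"
    unfolding cinner_self[symmetric] cinner_scaleC_left cinner_scaleC_right
    by (simp add: cinner_self power_mult_distrib flip: complex_norm_square)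
  then show ?thesis
    using power2_eq_imp_eq[of "norm (c *\<^sub>C x)" "cmod c * norm x"]
    by (simp only: of_real_eq_iff) simp
qed

text \<open>The norm is given and tied to the scalar product by \<open>cinner_self\<close>, so
  Cauchy-Schwarz is obtained backwards, by squaring the triangle inequality.\<close>

lemma Re_cinner_le: "Re (cinner x y) \<le> norm x * norm (y :: 'a::complex_inner)"
proof -
  have "(norm (x + y))\<^sup>2 \<le> (norm x + norm y)\<^sup>2"
    by (intro power_mono norm_triangle_ineq norm_ge_zero)
  then show ?thesis
    unfolding norm_add_sqr by (simp add: power2_eq_square algebra_simps)
qed

lemma cmod_cinner_le: "cmod (cinner x y) \<le> norm x * norm (y :: 'a::complex_inner)"
proof (cases "cinner x y = 0")
  case False
  \<comment> \<open>A phase of modulus 1 that makes the scalar product real and nonnegative, so that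
    the bound for real parts applies.\<close>
  define c where "c = cnj (sgn (cinner x y))"
  have c: "cmod c = 1"
    using False by (simp add: c_def norm_sgn)
  have "c * cinner x y = cmod (cinner x y)"
    using False
    by (simp add: c_def sgn_eq field_simps) (metis complex_norm_square of_real_power power2_eq_square)
  then have "cmod (cinner x y) = Re (cinner x (c *\<^sub>C y))"
    by (simp add: cinner_scaleC_right)
  also have "\<dots> \<le> norm x * norm y"
    using Re_cinner_le[of x "c *\<^sub>C y"] by (simp add: norm_scaleC c)
  finally show ?thesis .
qed simp

lemma bounded_bilinear_cinner: "bounded_bilinear (cinner :: 'a::complex_inner \<Rightarrow> 'a \<Rightarrow> complex)"
  by (standard; (intro exI[of _ 1])?)
    (simp_all add: cinner_add_left cinner_add_right cinner_scaleR_left cinner_scaleR_right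
      cmod_cinner_le)

interpretation cinner: bounded_bilinear "cinner :: 'a::complex_inner \<Rightarrow> 'a \<Rightarrow> complex"
  by (rule bounded_bilinear_cinner)

lemma norm_diff_sqr:
  "(norm (x - y))\<^sup>2 = (norm x)\<^sup>2 - 2 * Re (cinner x y) + (norm (y :: 'a::complex_inner))\<^sup>2"
  using norm_add_sqr[of x "- y"] by (simp add: cinner.minus_right)

lemma cinner_eq_zero_commute: "cinner x y = 0 \<longleftrightarrow> cinner y (x :: 'a::complex_inner) = 0"
  by (metis cinner_commute complex_cnj_zero)

lemma Re_cinner_self: "Re (cinner x x) = (norm (x :: 'a::complex_inner))\<^sup>2"
  by (simp add: cinner_self del: of_real_power)

lemma cinner_self_eq_zero [simp]: "cinner x x = 0 \<longleftrightarrow> (x :: 'a::complex_inner) = 0"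
  by (simp add: cinner_self)

lemma cinner_eqI:
  assumes "\<And>z. cinner x z = cinner y (z :: 'a::complex_inner)"
  shows "x = y"
proof -
  have "cinner (x - y) (x - y) = 0"
    by (simp add: cinner.diff_left assms)
  then show ?thesis by simp
qed

lemma bounded_linear_scaleC: "bounded_linear (\<lambda>x. c *\<^sub>C (x :: 'a::complex_inner))"
  by (rule bounded_linear_intro[where K = "cmod c"])
    (simp_all add: scaleC_add_right scaleC_scaleR_commute norm_scaleC)

text \<open>Multiplying \<open>u\<close> by the imaginary unit exchanges real and imaginary parts up
  to sign. Real variations therefore suffice in the minimisation below.\<close>

lemma cinner_eq_zeroI_Re:
  assumes "csubspace M" and "\<And>u. u \<in> M \<Longrightarrow> Re (cinner x u) = 0" and "u \<in> M"
  shows "cinner x (u :: 'a::complex_inner) = 0"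
proof -
  have "Re (cinner x (\<i> *\<^sub>C u)) = 0"
    using assms csubspace_scaleC by blast
  then show ?thesis
    using assms(2,3) by (simp add: cinner_scaleC_right complex_eq_iff)
qed

lemma csubspace_closure:
  assumes "csubspace S"
  shows "csubspace (closure (S :: 'a::complex_inner set))"
  unfolding csubspace_iff
proof (intro conjI ballI allI)
  show "0 \<in> closure S"
    using csubspace_0[OF assms] closure_subset by blast
next
  fix x y assume "x \<in> closure S" "y \<in> closure S"
  then obtain f g where "\<forall>n. f n \<in> S" "f \<longlonglongrightarrow> x" "\<forall>n. g n \<in> S" "g \<longlonglongrightarrow> y"
    unfolding closure_sequential by blast
  then show "x + y \<in> closure S"
    unfolding closure_sequential using csubspace_add[OF assms]
    by (intro exI[of _ "\<lambda>n. f n + g n"]) (auto intro: tendsto_add)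
next
  fix c x assume "x \<in> closure S"
  then obtain f where "\<forall>n. f n \<in> S" "f \<longlonglongrightarrow> x"
    unfolding closure_sequential by blast
  then show "c *\<^sub>C x \<in> closure S"
    unfolding closure_sequential using csubspace_scaleC[OF assms]
    by (intro exI[of _ "\<lambda>n. c *\<^sub>C f n"])
      (auto intro: bounded_linear.tendsto[OF bounded_linear_scaleC])
qed

text \<open>The product norm is Euclidean, so products are Hilbert spaces. One of them contains the
  graph of \<open>A\<close>; in another acts the model of \<open>G_op\<close>.\<close>

instantiation prod :: (complex_inner, complex_inner) complex_inner
begin

definition cinner_prod_def: "cinner p q = cinner (fst p) (fst q) + cinner (snd p) (snd q)"

instance
proof
  fix p q r :: "'a \<times> 'b" and c :: complex
  show "cinner p q = cnj (cinner q p)"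
    by (simp add: cinner_prod_def cinner_commute[of "fst p"] cinner_commute[of "snd p"])
  show "cinner p (q + r) = cinner p q + cinner p r"
    by (simp add: cinner_prod_def cinner_add_right)
  show "cinner p (c *\<^sub>C q) = c * cinner p q"
    by (simp add: cinner_prod_def scaleC_prod_def cinner_scaleC_right algebra_simps)
  show "cinner p p = complex_of_real ((norm p)\<^sup>2)"
    by (simp add: cinner_prod_def cinner_self norm_prod_def flip: of_real_add of_real_power)
qed

end

instance prod :: (chilbert_space, chilbert_space) chilbert_space ..

instance chilbert_space \<subseteq> banach ..

lemma cinner_Pair: "cinner (a, b) (c, d) = cinner a c + cinner b d"
  by (simp add: cinner_prod_def)

lemma scaleC_Pair: "c *\<^sub>C (a, b) = (c *\<^sub>C a, c *\<^sub>C b)"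
  by (simp add: scaleC_prod_def)

section \<open>Orthogonal projection\<close>

text \<open>Near t = 0 a nonzero linear term would dominate and take both signs. This serves as the
  first-order condition at a minimum, for distances and for positive forms.\<close>

lemma quadratic_nonneg_imp_linear_coeff_zero:
  fixes a b :: real
  assumes "\<And>t. 0 \<le> t * a + t\<^sup>2 * b"
  shows "a = 0"
proof (rule ccontr)
  assume "a \<noteq> 0"
  define s where "s = \<bar>b\<bar> + 1"
  have "s > 0" "b < s" by (auto simp: s_def)
  have "0 \<le> (- a / s) * a + (- a / s)\<^sup>2 * b" by (rule assms)
  also have "\<dots> = (a\<^sup>2 / s\<^sup>2) * (b - s)"
    using \<open>s > 0\<close> by (simp add: field_simps power2_eq_square)
  also have "\<dots> < 0"
    using \<open>a \<noteq> 0\<close> \<open>s > 0\<close> \<open>b < s\<close> by (intro mult_pos_neg) auto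
  finally show False by simp
qed

lemma parallelogram_law:
  "(norm (x + y))\<^sup>2 + (norm (x - y))\<^sup>2 = 2 * (norm x)\<^sup>2 + 2 * (norm (y :: 'a::complex_inner))\<^sup>2"
  by (simp add: norm_add_sqr norm_diff_sqr)

theorem orthogonal_projection_exists:
  fixes M :: "'a::chilbert_space set"
  assumes M: "csubspace M" and "closed M"
  obtains m where "m \<in> M" and "\<And>u. u \<in> M \<Longrightarrow> cinner (x - m) u = 0"
proof -
  define d where "d = infdist x M"
  have ne: "M \<noteq> {}" using csubspace_0[OF M] by auto
  have "d \<ge> 0" by (simp add: d_def infdist_nonneg)
  have d_le: "d \<le> norm (x - u)" if "u \<in> M" for u
    using infdist_le[OF that, of x] by (simp add: d_def dist_norm)
  have "\<exists>u\<in>M. norm (x - u) < d + 1 / Suc n" for n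
    using cInf_lessD[of "dist x ` M" "d + 1 / Suc n"] ne
    by (auto simp: d_def infdist_notempty dist_norm)
  then obtain u where u: "u n \<in> M" "norm (x - u n) < d + 1 / Suc n" for n by metis
  \<comment> \<open>The midpoint of two near-minimisers lies in \<open>M\<close>, so its distance
    from \<open>x\<close> is at least \<open>d\<close>, and the parallelogram law forces the two to
    be close. The constant is 4 (2 d + 1): expand the square of d + r with r = 1 / Suc N and use r *
    r \<le> r.\<close>
  have near: "(norm (u n - u k))\<^sup>2 \<le> (8 * d + 4) / Suc N" if "n \<ge> N" "k \<ge> N" for n k N
  proof -
    have bound: "(norm (x - u j))\<^sup>2 \<le> d\<^sup>2 + (2 * d + 1) / Suc N" if "j \<ge> N" for j
    proof -
      let ?r = "1 / real (Suc N)"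
      have "1 / real (Suc j) \<le> ?r" using that by (simp add: frac_le)
      then have "norm (x - u j) \<le> d + ?r" using u(2)[of j] by linarith
      then have "(norm (x - u j))\<^sup>2 \<le> (d + ?r)\<^sup>2" by (rule power_mono) simp
      also have "\<dots> = d\<^sup>2 + 2 * d * ?r + ?r * ?r" by (simp add: power2_eq_square algebra_simps)
      also have "?r * ?r \<le> ?r" by (rule mult_left_le) simp_all
      finally show ?thesis by (simp add: add_divide_distrib)
    qed
    have "(1 / 2) *\<^sub>R (u n + u k) \<in> M"
      by (intro csubspace_scaleR[OF M] csubspace_add[OF M] u)
    then have "d \<le> norm (x - (1 / 2) *\<^sub>R (u n + u k))" by (rule d_le)
    then have "d\<^sup>2 \<le> (norm (x - (1 / 2) *\<^sub>R (u n + u k)))\<^sup>2"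
      using \<open>d \<ge> 0\<close> by (rule power_mono)
    also have "x - (1 / 2) *\<^sub>R (u n + u k) = (1 / 2) *\<^sub>R ((x - u n) + (x - u k))"
      by (simp add: algebra_simps flip: scaleR_2)
    finally have "4 * d\<^sup>2 \<le> (norm ((x - u n) + (x - u k)))\<^sup>2"
      by (simp add: power2_eq_square)
    moreover have "(norm ((x - u n) + (x - u k)))\<^sup>2 + (norm ((x - u n) - (x - u k)))\<^sup>2
        \<le> 4 * d\<^sup>2 + 4 * ((2 * d + 1) / Suc N)"
      unfolding parallelogram_law using bound[OF that(1)] bound[OF that(2)] by linarith
    ultimately have "(norm ((x - u n) - (x - u k)))\<^sup>2 \<le> 4 * ((2 * d + 1) / Suc N)"
      by linarith
    also have "\<dots> = (8 * d + 4) / Suc N" by (simp add: algebra_simps)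
    finally show ?thesis by (simp add: norm_minus_commute)
  qed
  have "Cauchy u"
  proof (rule metric_CauchyI)
    fix e :: real assume "e > 0"
    obtain N :: nat where N: "(8 * d + 4) / e\<^sup>2 < N" using reals_Archimedean2 by blast
    have "dist (u n) (u k) < e" if "n \<ge> N" "k \<ge> N" for n k
    proof -
      have "(norm (u n - u k))\<^sup>2 \<le> (8 * d + 4) / Suc N" by (rule near[OF that])
      also have "\<dots> < e\<^sup>2"
      proof -
        have "8 * d + 4 < N * e\<^sup>2" using N \<open>e > 0\<close> by (simp add: field_simps)
        also have "\<dots> \<le> Suc N * e\<^sup>2" by (intro mult_right_mono) auto
        finally show ?thesis by (simp add: field_simps)
      qed
      finally show ?thesis
        using \<open>e > 0\<close> by (simp add: dist_norm power_less_imp_less_base)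
    qed
    then show "\<exists>N. \<forall>n\<ge>N. \<forall>k\<ge>N. dist (u n) (u k) < e" by blast
  qed
  then obtain m where m: "u \<longlonglongrightarrow> m" using Cauchy_convergent convergent_def by blast
  have "m \<in> M" using closed_sequentially[OF \<open>closed M\<close>] u(1) m by blast
  have "(\<lambda>n. norm (x - u n)) \<longlonglongrightarrow> norm (x - m)" by (intro tendsto_intros m)
  moreover have "(\<lambda>n. d + 1 / real (Suc n)) \<longlonglongrightarrow> d + 0"
    by (intro tendsto_intros LIMSEQ_Suc lim_1_over_n)
  ultimately have "norm (x - m) \<le> d + 0"
    using u(2) by (intro LIMSEQ_le[where X = "\<lambda>n. norm (x - u n)"]) (auto intro: less_imp_le)
  then have dm: "norm (x - m) \<le> d" by simp
  have "Re (cinner (x - m) v) = 0" if v: "v \<in> M" for v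
  proof -
    \<comment> \<open>Minimality of the distance at \<open>m\<close>, tested along the line m + t
      v.\<close>
    have "0 \<le> t * (- 2 * Re (cinner (x - m) v)) + t\<^sup>2 * (norm v)\<^sup>2" for t :: real
    proof -
      have "m + t *\<^sub>R v \<in> M" using \<open>m \<in> M\<close> v by (intro csubspace_add[OF M] csubspace_scaleR[OF M])
      then have "norm (x - m) \<le> norm (x - (m + t *\<^sub>R v))" using d_le dm by fastforce
      then have "(norm (x - m))\<^sup>2 \<le> (norm ((x - m) - t *\<^sub>R v))\<^sup>2"
        by (simp add: power_mono diff_diff_eq)
      then show ?thesis
        by (simp add: norm_diff_sqr[of "x - m"] cinner_scaleR_right power_mult_distrib)
    qed
    from quadratic_nonneg_imp_linear_coeff_zero[OF this] show ?thesis by simp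
  qed
  with \<open>m \<in> M\<close> that show thesis using cinner_eq_zeroI_Re[OF M] by blast
qed

text \<open>The residue of the projection onto the closure is orthogonal to \<open>S\<close>, hence
  zero.\<close>

corollary dense_csubspaceI:
  fixes S :: "'a::chilbert_space set"
  assumes S: "csubspace S" and orth: "\<And>y. (\<And>x. x \<in> S \<Longrightarrow> cinner y x = 0) \<Longrightarrow> y = 0"
  shows "closure S = UNIV"
proof -
  have "x \<in> closure S" for x
  proof -
    obtain m where m: "m \<in> closure S" "\<And>u. u \<in> closure S \<Longrightarrow> cinner (x - m) u = 0"
      using orthogonal_projection_exists[OF csubspace_closure[OF S] closed_closure] by blast
    then have "x - m = 0" using closure_subset by (intro orth) blast
    with m show ?thesis by simp
  qed
  then show ?thesis by blast
qed

section \<open>The closed graph theorem\<close>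

text \<open>The convergence criterion shared by the closed graph argument, the square root iteration
  and the Euler scheme.\<close>

lemma convergent_if_summable_increments:
  fixes f :: "nat \<Rightarrow> 'a::banach"
  assumes "summable a" and "\<And>n. norm (f (Suc n) - f n) \<le> a n"
  shows "convergent f"
proof -
  have "summable (\<lambda>n. f (Suc n) - f n)"
    using assms by (rule summable_comparison_test'[where N = 0])
  then have "(\<lambda>n. \<Sum>k<n. f (Suc k) - f k) \<longlonglongrightarrow> (\<Sum>k. f (Suc k) - f k)"
    by (rule summable_LIMSEQ)
  then have "(\<lambda>n. f 0 + (\<Sum>k<n. f (Suc k) - f k)) \<longlonglongrightarrow> f 0 + (\<Sum>k. f (Suc k) - f k)"
    by (intro tendsto_intros)
  then show ?thesis
    by (auto simp: sum_lessThan_telescope convergent_def)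
qed

text \<open>By Baire, the closure of some set where \<open>F\<close> is bounded by n contains a
  ball. A direction is a difference of two points of that ball, and only closures are available, so
  it is hit approximately by vectors with controlled image.\<close>

lemma linear_approximately_bounded:
  fixes F :: "'a::banach \<Rightarrow> 'b::real_normed_vector"
  assumes "linear F"
  obtains M where "M \<ge> 0" and "\<And>x. \<exists>z. norm (x - z) \<le> norm x / 2 \<and> norm (F z) \<le> M * norm x"
proof -
  interpret linear F by (rule assms)
  define E where "E n = closure {x. norm (F x) \<le> real n}" for n
  have "\<Union>(range E) = UNIV"
  proof -
    have "x \<in> \<Union>(range E)" for x
    proof -
      obtain n :: nat where "norm (F x) \<le> n" using real_arch_simple by blast
      then have "x \<in> E n" unfolding E_def by (intro subsetD[OF closure_subset]) simp
      then show ?thesis by blast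
    qed
    then show ?thesis by blast
  qed
  moreover have "euclidean interior_of \<Union>(range E) = {}"
    if empty: "\<And>n. interior (E n) = {}"
  proof (rule Baire_category_alt)
    show "closedin euclidean T \<and> euclidean interior_of T = {}" if "T \<in> range E" for T
    proof -
      obtain n where "T = E n" using \<open>T \<in> range E\<close> by blast
      moreover have "closed (E n)" by (simp add: E_def)
      ultimately show ?thesis using empty[of n] by simp
    qed
  qed (simp_all add: completely_metrizable_space_euclidean)
  ultimately obtain n where "interior (E n) \<noteq> {}" by fastforce
  then obtain x0 r where "r > 0" and r: "ball x0 r \<subseteq> E n"
    by (metis ex_in_conv mem_interior)
  define M where "M = 4 * n / r"
  show thesis
  proof
    show "M \<ge> 0" using \<open>r > 0\<close> by (simp add: M_def)
    fix x
    show "\<exists>z. norm (x - z) \<le> norm x / 2 \<and> norm (F z) \<le> M * norm x"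
    proof (cases "x = 0")
      case False
      \<comment> \<open>Scaling \<open>x\<close> to length r / 2 keeps x0 + s x inside the ball.
        With e = r / 8 the error 2 e / s is then exactly half of the norm of
        \<open>x\<close>.\<close>
      define s where "s = r / (2 * norm x)"
      have "s > 0" using False \<open>r > 0\<close> by (simp add: s_def)
      define e where "e = r / 8"
      have "e > 0" using \<open>r > 0\<close> by (simp add: e_def)
      have "x0 + s *\<^sub>R x \<in> E n" "x0 \<in> E n"
        using False \<open>r > 0\<close> r by (auto simp: s_def dist_norm)
      then obtain u v where u: "dist u (x0 + s *\<^sub>R x) < e" "norm (F u) \<le> n"
        and v: "dist v x0 < e" "norm (F v) \<le> n"
        unfolding E_def closure_approachable using \<open>e > 0\<close> by blast
      define z where "z = (1 / s) *\<^sub>R (u - v)"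
      have "norm (s *\<^sub>R x - (u - v)) \<le> norm (u - (x0 + s *\<^sub>R x)) + norm (v - x0)"
        using norm_triangle_ineq4[of "v - x0" "u - (x0 + s *\<^sub>R x)"]
        by (simp add: algebra_simps)
      also have "\<dots> \<le> 2 * e" using u v by (simp add: dist_norm)
      finally have *: "norm (s *\<^sub>R x - (u - v)) \<le> 2 * e" .
      have "x - z = (1 / s) *\<^sub>R (s *\<^sub>R x - (u - v))"
        using \<open>s > 0\<close> by (simp add: z_def scaleR_diff_right)
      then have "norm (x - z) = norm (s *\<^sub>R x - (u - v)) / s" using \<open>s > 0\<close> by simp
      also have "\<dots> \<le> 2 * e / s" using * \<open>s > 0\<close> by (simp add: divide_right_mono)
      also have "\<dots> = norm x / 2" using \<open>r > 0\<close> False by (simp add: e_def s_def)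
      finally have 1: "norm (x - z) \<le> norm x / 2" .
      have "norm (F z) = norm (F u - F v) / s"
        using \<open>s > 0\<close> by (simp add: z_def scale diff)
      also have "\<dots> \<le> (2 * n) / s"
        using norm_triangle_ineq4[of "F u" "F v"] u v \<open>s > 0\<close> by (intro divide_right_mono) auto
      also have "\<dots> = M * norm x" using \<open>r > 0\<close> False by (simp add: M_def s_def)
      finally show ?thesis using 1 by blast
    qed (auto intro: exI[of _ 0])
  qed
qed

text \<open>Approximating the remainder again and again writes \<open>x\<close> as a series of
  vectors whose images are dominated by a geometric series. The factor 2 in the bound is the sum of
  that series.\<close>

theorem closable_everywhere_defined_bounded:
  fixes F :: "'a::banach \<Rightarrow> 'b::banach"
  assumes "linear F"
    and closable: "\<And>x y. x \<longlonglongrightarrow> 0 \<Longrightarrow> (\<lambda>n. F (x n)) \<longlonglongrightarrow> y \<Longrightarrow> y = 0"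
  shows "bounded_linear F"
proof -
  interpret linear F by (rule assms)
  obtain M where "M \<ge> 0" and "\<And>x. \<exists>z. norm (x - z) \<le> norm x / 2 \<and> norm (F z) \<le> M * norm x"
    using linear_approximately_bounded[OF \<open>linear F\<close>] by blast
  then obtain z where z: "norm (x - z x) \<le> norm x / 2" "norm (F (z x)) \<le> M * norm x" for x
    by metis
  have "norm (F x) \<le> norm x * (2 * M)" for x
  proof -
    define r where "r = rec_nat x (\<lambda>_ y. y - z y)"
    have r0: "r 0 = x" and r_Suc: "r (Suc m) = r m - z (r m)" for m by (simp_all add: r_def)
    have r_le: "norm (r m) \<le> norm x * (1 / 2) ^ m" for m
    proof (induction m)
      case (Suc m)
      then show ?case using z(1)[of "r m"] by (simp add: r_Suc)
    qed (simp add: r0)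
    let ?a = "\<lambda>m. M * norm x * (1 / 2) ^ m"
    have step: "norm (F (r (Suc m)) - F (r m)) \<le> ?a m" for m
    proof -
      have "F (r (Suc m)) - F (r m) = - F (z (r m))" by (simp add: r_Suc diff)
      then have "norm (F (r (Suc m)) - F (r m)) \<le> M * norm (r m)" by (simp add: z)
      also have "\<dots> \<le> M * (norm x * (1 / 2) ^ m)" using r_le \<open>M \<ge> 0\<close> by (rule mult_left_mono)
      finally show ?thesis by (simp add: mult.assoc)
    qed
    have sums: "?a sums (M * norm x * 2)"
      using sums_mult[OF geometric_sums[of "1 / 2 :: real"], of "M * norm x"] by simp
    have "convergent (\<lambda>m. F (r m))"
      using convergent_if_summable_increments[of ?a, OF sums_summable[OF sums] step] .
    then obtain y where y: "(\<lambda>m. F (r m)) \<longlonglongrightarrow> y" by (auto simp: convergent_def)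
    have "(\<lambda>m. norm x * (1 / 2) ^ m) \<longlonglongrightarrow> norm x * 0"
      by (intro tendsto_intros LIMSEQ_realpow_zero) auto
    then have "r \<longlonglongrightarrow> 0"
      using r_le by (intro Lim_null_comparison[of r]) auto
    \<comment> \<open>Closability enters here: the limit exists by the geometric bound, and it must
      be 0 because the remainders tend to 0.\<close>
    then have "(\<lambda>m. F (r m)) \<longlonglongrightarrow> 0" using closable y by blast
    then have lim: "(\<lambda>m. norm (F (r m) - F x)) \<longlonglongrightarrow> norm (0 - F x)" by (intro tendsto_intros)
    have "norm (F (r m) - F x) \<le> M * norm x * 2" for m
    proof -
      have "F (r m) - F x = (\<Sum>k<m. F (r (Suc k)) - F (r k))"
        by (simp add: sum_lessThan_telescope[of "\<lambda>k. F (r k)"] r0)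
      also have "norm \<dots> \<le> (\<Sum>k<m. ?a k)" by (intro order_trans[OF norm_sum] sum_mono step)
      also have "\<dots> \<le> M * norm x * 2"
        unfolding sums_unique[OF sums] using \<open>M \<ge> 0\<close>
        by (intro sum_le_suminf sums_summable[OF sums]) auto
      finally show ?thesis .
    qed
    then have "norm (0 - F x) \<le> M * norm x * 2" by (intro LIMSEQ_le_const2[OF lim]) blast
    then show ?thesis by (simp add: algebra_simps)
  qed
  then show ?thesis by (intro bounded_linear_intro[where K = "2 * M"]) (simp_all add: add scale)
qed

section \<open>Square roots of bounded positive operators\<close>

definition symmetric_op :: "('a::complex_inner \<Rightarrow> 'a) \<Rightarrow> bool"
  where "symmetric_op F \<longleftrightarrow> (\<forall>x y. cinner (F x) y = cinner x (F y))"

definition positive_op :: "('a::complex_inner \<Rightarrow> 'a) \<Rightarrow> bool"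
  where "positive_op F \<longleftrightarrow> (\<forall>x. Re (cinner x (F x)) \<ge> 0)"

lemma symmetric_opD: "symmetric_op F \<Longrightarrow> cinner (F x) y = cinner x (F y)"
  by (simp add: symmetric_op_def)

text \<open>The nonnegative form is minimal at \<open>x\<close>, so its first variation in the
  direction \<open>F x\<close>, which is twice the squared norm of \<open>F x\<close>,
  vanishes.\<close>

lemma positive_op_eq_zero:
  fixes F :: "'a::complex_inner \<Rightarrow>\<^sub>L 'a"
  assumes "symmetric_op F" "positive_op F" "Re (cinner x (F x)) = 0"
  shows "F x = 0"
proof -
  let ?w = "F x"
  have "0 \<le> t * (2 * (norm ?w)\<^sup>2) + t\<^sup>2 * Re (cinner ?w (F ?w))" for t :: real
  proof -
    have "0 \<le> Re (cinner (x + t *\<^sub>R ?w) (F (x + t *\<^sub>R ?w)))"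
      using assms(2) by (simp add: positive_op_def)
    also have "\<dots> = Re (cinner x (F x)) + t * Re (cinner x (F ?w)) + t * Re (cinner ?w ?w)
        + t * t * Re (cinner ?w (F ?w))"
      by (simp add: blinfun.bilinear_simps cinner_add_left cinner_add_right cinner_scaleR_left
          cinner_scaleR_right algebra_simps)
    also have "cinner x (F ?w) = cinner ?w ?w" using symmetric_opD[OF assms(1)] by metis
    finally show ?thesis using assms(3) by (simp add: Re_cinner_self power2_eq_square)
  qed
  then have "2 * (norm ?w)\<^sup>2 = 0" by (rule quadratic_nonneg_imp_linear_coeff_zero)
  then show ?thesis by simp
qed

text \<open>Commutation and equal squares give (C + D)(C - D) = 0. With y = (C - D) x, positivity
  splits this into C y = 0 and D y = 0, and moving C - D across the scalar product gives (y, y) =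
  0.\<close>

lemma positive_sqrt_unique:
  fixes C D :: "'a::complex_inner \<Rightarrow>\<^sub>L 'a"
  assumes C: "symmetric_op C" "positive_op C" and D: "symmetric_op D" "positive_op D"
    and sq: "C o\<^sub>L C = D o\<^sub>L D" and comm: "C o\<^sub>L D = D o\<^sub>L C"
  shows "C = D"
proof (rule blinfun_eqI)
  fix x
  have sq': "C (C z) = D (D z)" and comm': "C (D z) = D (C z)" for z
    by (metis sq blinfun_apply_blinfun_compose) (metis comm blinfun_apply_blinfun_compose)
  let ?y = "C x - D x"
  have "C ?y + D ?y = 0" by (simp add: blinfun.bilinear_simps sq' comm')
  then have "Re (cinner ?y (C ?y)) + Re (cinner ?y (D ?y)) = 0"
    by (simp add: cinner.zero_right flip: cinner_add_right plus_complex.sel)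
  then have "Re (cinner ?y (C ?y)) = 0" "Re (cinner ?y (D ?y)) = 0"
    using C(2)[unfolded positive_op_def, rule_format, of ?y]
      D(2)[unfolded positive_op_def, rule_format, of ?y] by linarith+
  then have "C ?y = 0" "D ?y = 0" using positive_op_eq_zero C D by blast+
  then have "cinner ?y ?y = 0"
    using symmetric_opD[OF C(1), of x ?y] symmetric_opD[OF D(1), of x ?y]
    by (simp add: cinner.diff_left)
  then show "C x = D x" by simp
qed

text \<open>The iteration \<open>Y \<mapsto> (Z + Y\<^sup>2) / 2\<close> produces polynomials in \<open>Z\<close> with nonnegative
  coefficients, so its increments are dominated by those for the scalar \<open>Z = 1\<close>, which
  converge monotonically.  The limit solves \<open>(1 - Y)\<^sup>2 = 1 - Z\<close>.\<close>

primrec sqrt_iter :: "('a::real_normed_vector \<Rightarrow>\<^sub>L 'a) \<Rightarrow> nat \<Rightarrow> ('a \<Rightarrow>\<^sub>L 'a)"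
  where "sqrt_iter Z 0 = 0"
  | "sqrt_iter Z (Suc n) = (1 / 2) *\<^sub>R (Z + (sqrt_iter Z n o\<^sub>L sqrt_iter Z n))"

primrec sqrt_iter_majorant :: "nat \<Rightarrow> real"
  where "sqrt_iter_majorant 0 = 0"
  | "sqrt_iter_majorant (Suc n) = (1 + (sqrt_iter_majorant n)\<^sup>2) / 2"

lemma sqrt_iter_majorant_bounds: "0 \<le> sqrt_iter_majorant n" "sqrt_iter_majorant n \<le> 1"
proof -
  have "0 \<le> sqrt_iter_majorant n \<and> sqrt_iter_majorant n \<le> 1"
  proof (induction n)
    case (Suc n)
    then have "(sqrt_iter_majorant n)\<^sup>2 \<le> 1" by (simp add: power_le_one)
    then show ?case by simp
  qed simp
  then show "0 \<le> sqrt_iter_majorant n" "sqrt_iter_majorant n \<le> 1" by auto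
qed

lemma norm_sqrt_iter_le:
  assumes "norm Z \<le> 1"
  shows "norm (sqrt_iter Z n) \<le> sqrt_iter_majorant n"
proof (induction n)
  case (Suc n)
  have "norm (sqrt_iter Z n o\<^sub>L sqrt_iter Z n) \<le> norm (sqrt_iter Z n) * norm (sqrt_iter Z n)"
    by (rule norm_blinfun_compose)
  also have "\<dots> \<le> (sqrt_iter_majorant n)\<^sup>2"
    unfolding power2_eq_square by (intro mult_mono Suc.IH sqrt_iter_majorant_bounds norm_ge_zero)
  finally have "norm (Z + (sqrt_iter Z n o\<^sub>L sqrt_iter Z n)) \<le> 1 + (sqrt_iter_majorant n)\<^sup>2"
    using assms by (intro order_trans[OF norm_triangle_ineq] add_mono)
  then show ?case by simp
qed simp

lemma norm_sqrt_iter_increment_le: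
  assumes "norm Z \<le> 1"
  shows "norm (sqrt_iter Z (Suc n) - sqrt_iter Z n)
    \<le> sqrt_iter_majorant (Suc n) - sqrt_iter_majorant n"
proof (induction n)
  case 0
  then show ?case using assms by simp
next
  case (Suc n)
  let ?X = "sqrt_iter Z (Suc n)" and ?Y = "sqrt_iter Z n"
  let ?x = "sqrt_iter_majorant (Suc n)" and ?y = "sqrt_iter_majorant n"
  \<comment> \<open>This splitting of the difference of squares does not require the factors to
    commute, and its norm bound is exactly the scalar difference of squares.\<close>
  have "sqrt_iter Z (Suc (Suc n)) - ?X = (1 / 2) *\<^sub>R ((?X o\<^sub>L (?X - ?Y)) + ((?X - ?Y) o\<^sub>L ?Y))"
    unfolding sqrt_iter.simps(2)[of Z "Suc n"]
    by (subst (2) sqrt_iter.simps(2))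
      (simp add: bounded_bilinear.diff_left[OF bounded_bilinear_blinfun_compose]
        bounded_bilinear.diff_right[OF bounded_bilinear_blinfun_compose] scaleR_diff_right
        scaleR_add_right del: sqrt_iter.simps)
  also have "norm \<dots> \<le> 1 / 2 * (?x * (?x - ?y) + (?x - ?y) * ?y)"
  proof -
    have "norm (?X o\<^sub>L (?X - ?Y)) \<le> ?x * (?x - ?y)"
      by (intro order_trans[OF norm_blinfun_compose] mult_mono norm_sqrt_iter_le assms Suc.IH
          sqrt_iter_majorant_bounds norm_ge_zero)
    moreover have "norm ((?X - ?Y) o\<^sub>L ?Y) \<le> (?x - ?y) * ?y"
      by (intro order_trans[OF norm_blinfun_compose] mult_mono norm_sqrt_iter_le assms Suc.IH
          order_trans[OF norm_ge_zero Suc.IH] norm_ge_zero)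
    ultimately have "norm ((?X o\<^sub>L (?X - ?Y)) + ((?X - ?Y) o\<^sub>L ?Y)) \<le> ?x * (?x - ?y) + (?x - ?y) * ?y"
      by (intro order_trans[OF norm_triangle_ineq] add_mono)
    then show ?thesis by (simp del: sqrt_iter.simps sqrt_iter_majorant.simps)
  qed
  also have "\<dots> = (?x\<^sup>2 - ?y\<^sup>2) / 2" by (simp add: power2_eq_square algebra_simps del: sqrt_iter_majorant.simps)
  also have "\<dots> = sqrt_iter_majorant (Suc (Suc n)) - ?x"
    unfolding sqrt_iter_majorant.simps(2)[of "Suc n"]
    by (subst (3) sqrt_iter_majorant.simps(2)) (simp add: field_simps del: sqrt_iter_majorant.simps)
  finally show ?case .
qed

lemma sqrt_iter_convergent:
  fixes Z :: "'a::banach \<Rightarrow>\<^sub>L 'a"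
  assumes "norm Z \<le> 1"
  shows "convergent (sqrt_iter Z)"
proof (rule convergent_if_summable_increments)
  show "norm (sqrt_iter Z (Suc n) - sqrt_iter Z n)
      \<le> sqrt_iter_majorant (Suc n) - sqrt_iter_majorant n" for n
    by (rule norm_sqrt_iter_increment_le[OF assms])
  show "summable (\<lambda>n. sqrt_iter_majorant (Suc n) - sqrt_iter_majorant n)"
  proof (rule summableI_nonneg_bounded)
    show "0 \<le> sqrt_iter_majorant (Suc n) - sqrt_iter_majorant n" for n
      using norm_sqrt_iter_increment_le[OF assms, of n] norm_ge_zero order_trans by blast
    show "(\<Sum>i<n. sqrt_iter_majorant (Suc i) - sqrt_iter_majorant i) \<le> 1" for n
      \<comment> \<open>The scalar increments telescope, so boundedness of the majorant by 1 is all
        that summability needs.\<close>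
      unfolding sum_lessThan_telescope using sqrt_iter_majorant_bounds(2) by simp
  qed
qed

lemma sqrt_iter_commute:
  assumes "T o\<^sub>L Z = Z o\<^sub>L T"
  shows "T o\<^sub>L sqrt_iter Z n = sqrt_iter Z n o\<^sub>L T"
proof (induction n)
  case (Suc n)
  have "T (Z x) = Z (T x)" "T (sqrt_iter Z n x) = sqrt_iter Z n (T x)" for x
    by (metis assms blinfun_apply_blinfun_compose) (metis Suc blinfun_apply_blinfun_compose)
  then show ?case
    by (intro blinfun_eqI) (simp add: blinfun.bilinear_simps)
qed simp

lemma symmetric_sqrt_iter:
  fixes Z :: "'a::complex_inner \<Rightarrow>\<^sub>L 'a"
  assumes "symmetric_op Z"
  shows "symmetric_op (sqrt_iter Z n)"
  by (induction n)
    (use assms in \<open>simp_all add: symmetric_op_def blinfun.bilinear_simps cinner_add_left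
      cinner_add_right cinner_scaleR_left cinner_scaleR_right\<close>)

text \<open>The hypothesis makes Z = 1 - K / c a contraction. The commutation property of the root
  is used twice: with a complex multiplication, for complex linearity, and with a competing root,
  for uniqueness.\<close>

theorem positive_sqrt_exists:
  fixes K :: "'a::chilbert_space \<Rightarrow>\<^sub>L 'a"
  assumes sym: "symmetric_op K" and "c > 0"
    and K_le: "\<And>x. (norm (K x))\<^sup>2 \<le> c * Re (cinner x (K x))"
  obtains C where "C o\<^sub>L C = K" "symmetric_op C" "positive_op C"
    "\<And>T. T o\<^sub>L K = K o\<^sub>L T \<Longrightarrow> T o\<^sub>L C = C o\<^sub>L T"
proof -
  define Z where "Z = id_blinfun - (1 / c) *\<^sub>R K"
  have Z_apply: "Z x = x - (1 / c) *\<^sub>R K x" for x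
    by (simp add: Z_def blinfun.bilinear_simps)
  have "norm (Z x) \<le> 1 * norm x" for x
  proof -
    have "(norm (Z x))\<^sup>2 = (norm x)\<^sup>2 - 2 / c * Re (cinner x (K x)) + (norm (K x))\<^sup>2 / c\<^sup>2"
      by (simp add: Z_apply norm_diff_sqr cinner_scaleR_right power_divide)
    also have "(norm (K x))\<^sup>2 / c\<^sup>2 \<le> Re (cinner x (K x)) / c"
      using K_le[of x] \<open>c > 0\<close>
      by (simp add: divide_simps power2_eq_square mult.commute)
    also have "(norm x)\<^sup>2 - 2 / c * Re (cinner x (K x)) + Re (cinner x (K x)) / c
        = (norm x)\<^sup>2 - Re (cinner x (K x)) / c" by (simp add: field_simps)
    also have "\<dots> \<le> (norm x)\<^sup>2"
    proof -
      have "0 \<le> c * Re (cinner x (K x))" using K_le[of x] zero_le_power2 order_trans by blast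
      then show ?thesis using \<open>c > 0\<close> by (simp add: zero_le_mult_iff)
    qed
    finally show ?thesis using power2_le_imp_le by fastforce
  qed
  then have normZ: "norm Z \<le> 1" by (intro norm_blinfun_bound) auto
  have symZ: "symmetric_op Z"
    using sym by (simp add: symmetric_op_def Z_apply cinner.diff_left cinner.diff_right
        cinner_scaleR_left cinner_scaleR_right)
  obtain Y where Y: "sqrt_iter Z \<longlonglongrightarrow> Y"
    using sqrt_iter_convergent[OF normZ] by (auto simp: convergent_def)
  have Y_apply: "(\<lambda>n. sqrt_iter Z n x) \<longlonglongrightarrow> Y x" for x
    by (intro bounded_linear.tendsto[OF blinfun.bounded_linear_left] Y)
  have "(\<lambda>n. sqrt_iter Z (Suc n)) \<longlonglongrightarrow> (1 / 2) *\<^sub>R (Z + (Y o\<^sub>L Y))"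
    unfolding sqrt_iter.simps
    by (intro tendsto_intros Y bounded_bilinear.tendsto[OF bounded_bilinear_blinfun_compose])
  then have Y_eq: "Y = (1 / 2) *\<^sub>R (Z + (Y o\<^sub>L Y))"
    using LIMSEQ_unique[OF LIMSEQ_Suc[OF Y]] by blast
  have Y_twice: "2 *\<^sub>R Y x = Z x + Y (Y x)" for x
    using arg_cong[OF Y_eq, of "\<lambda>f. 2 *\<^sub>R blinfun_apply f x"]
    by (simp add: blinfun.bilinear_simps)
  have normY: "norm Y \<le> 1"
  proof (rule LIMSEQ_le_const2[OF tendsto_norm[OF Y]])
    show "\<exists>N. \<forall>n\<ge>N. norm (sqrt_iter Z n) \<le> 1"
      using norm_sqrt_iter_le[OF normZ] sqrt_iter_majorant_bounds(2) order_trans by blast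
  qed
  have symY: "symmetric_op Y"
    unfolding symmetric_op_def
  proof (intro allI)
    fix x y
    have "(\<lambda>n. cinner (sqrt_iter Z n x) y) \<longlonglongrightarrow> cinner (Y x) y"
      "(\<lambda>n. cinner x (sqrt_iter Z n y)) \<longlonglongrightarrow> cinner x (Y y)"
      by (intro cinner.tendsto Y_apply tendsto_const)+
    then show "cinner (Y x) y = cinner x (Y y)"
      by (simp add: symmetric_opD[OF symmetric_sqrt_iter[OF symZ]] LIMSEQ_unique)
  qed
  define C where "C = sqrt c *\<^sub>R (id_blinfun - Y)"
  have C_apply: "C x = sqrt c *\<^sub>R (x - Y x)" for x
    by (simp add: C_def blinfun.bilinear_simps)
  show thesis
  proof
    show "C o\<^sub>L C = K"
    proof (rule blinfun_eqI)
      fix x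
      have "(C o\<^sub>L C) x = (sqrt c * sqrt c) *\<^sub>R (x - 2 *\<^sub>R Y x + Y (Y x))"
        by (simp add: C_apply blinfun.bilinear_simps scaleR_2 algebra_simps)
      also have "\<dots> = c *\<^sub>R (x - Z x)" using \<open>c > 0\<close> by (simp add: Y_twice)
      also have "\<dots> = K x" using \<open>c > 0\<close> by (simp add: Z_apply)
      finally show "(C o\<^sub>L C) x = K x" .
    qed
    show "symmetric_op C"
      using symY by (simp add: symmetric_op_def C_apply cinner.diff_left cinner.diff_right
          cinner_scaleR_left cinner_scaleR_right)
    show "positive_op C"
      unfolding positive_op_def
    proof
      fix x
      have "Re (cinner x (Y x)) \<le> norm x * norm (Y x)" by (rule Re_cinner_le)
      also have "\<dots> \<le> norm x * (1 * norm x)"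
        by (intro mult_left_mono order_trans[OF norm_blinfun] mult_right_mono normY norm_ge_zero)
      finally have "0 \<le> Re (cinner x (x - Y x))"
        by (simp add: cinner.diff_right Re_cinner_self power2_eq_square)
      then show "0 \<le> Re (cinner x (C x))"
        using \<open>c > 0\<close> by (simp add: C_apply cinner_scaleR_right)
    qed
    fix T assume "T o\<^sub>L K = K o\<^sub>L T"
    then have "T (K x) = K (T x)" for x by (metis blinfun_apply_blinfun_compose)
    then have "T o\<^sub>L Z = Z o\<^sub>L T"
      by (intro blinfun_eqI) (simp add: Z_apply blinfun.bilinear_simps)
    then have "T o\<^sub>L sqrt_iter Z n = sqrt_iter Z n o\<^sub>L T" for n by (rule sqrt_iter_commute)
    moreover have "(\<lambda>n. T o\<^sub>L sqrt_iter Z n) \<longlonglongrightarrow> (T o\<^sub>L Y)" "(\<lambda>n. sqrt_iter Z n o\<^sub>L T) \<longlonglongrightarrow> (Y o\<^sub>L T)"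
      by (intro bounded_bilinear.tendsto[OF bounded_bilinear_blinfun_compose] Y tendsto_const)+
    ultimately have "T o\<^sub>L Y = Y o\<^sub>L T" using LIMSEQ_unique by fastforce
    then have "T (Y x) = Y (T x)" for x by (metis blinfun_apply_blinfun_compose)
    then show "T o\<^sub>L C = C o\<^sub>L T"
      by (intro blinfun_eqI) (simp add: C_apply blinfun.bilinear_simps)
  qed
qed

section \<open>Operators as graphs\<close>

lemma app_eqI: "single_valued T \<Longrightarrow> (x, y) \<in> T \<Longrightarrow> app T x = y"
  unfolding app_def single_valued_def by blast

lemma app_mem: "single_valued T \<Longrightarrow> x \<in> Domain T \<Longrightarrow> (x, app T x) \<in> T"
  by (metis DomainE app_eqI)

lemma app_mk_op [simp]: "x \<in> D \<Longrightarrow> app (mk_op D F) x = F x"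
  by (rule app_eqI) (auto simp: mk_op_def single_valued_def)

lemma
  assumes "csubspace T"
  shows graph_zero: "(0, 0) \<in> T"
    and graph_add: "(x, y) \<in> T \<Longrightarrow> (x', y') \<in> T \<Longrightarrow> (x + x', y + y') \<in> T"
    and graph_diff: "(x, y) \<in> T \<Longrightarrow> (x', y') \<in> T \<Longrightarrow> (x - x', y - y') \<in> T"
    and graph_scaleC: "(x, y) \<in> T \<Longrightarrow> (c *\<^sub>C x, c *\<^sub>C y) \<in> T"
    and graph_scaleR: "(x, y) \<in> T \<Longrightarrow> (r *\<^sub>R x, r *\<^sub>R y) \<in> T"
  using csubspace_0[OF assms] csubspace_add[OF assms, of "(x, y)" "(x', y')"]
    csubspace_diff[OF assms, of "(x, y)" "(x', y')"] csubspace_scaleC[OF assms, of "(x, y)" c]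
    csubspace_scaleR[OF assms, of "(x, y)" r]
  by (simp_all add: scaleC_Pair zero_prod_def)

lemma csubspace_Domain: "csubspace T \<Longrightarrow> csubspace (Domain T)"
  unfolding csubspace_iff[of "Domain T"]
  by (blast intro: graph_zero graph_add graph_scaleC)

lemma linear_op_univ_space:
  "linear_op univ_space univ_space T \<longleftrightarrow> csubspace T \<and> single_valued T"
  by (simp add: linear_op_def univ_space_def)

lemma densely_defined_univ_space:
  "densely_defined univ_space T \<longleftrightarrow> closure (Domain T) = UNIV"
  by (simp add: densely_defined_def htop_univ_space) (simp add: univ_space_def)

lemma prod_topology_euclidean:
  "prod_topology (euclidean :: 'a::topological_space topology)
    (euclidean :: 'b::topological_space topology) = euclidean"
  unfolding topology_eq openin_prod_topology_alt open_openin[symmetric] open_prod_def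
  by (simp add: Ball_def)

lemma closed_op_univ_space:
  "closed_op univ_space univ_space T \<longleftrightarrow> csubspace T \<and> single_valued T \<and> closed T"
  by (simp add: closed_op_def linear_op_univ_space htop_univ_space prod_topology_euclidean)

lemma op_comp_iff: "(x, z) \<in> S \<odot> T \<longleftrightarrow> (\<exists>y. (x, y) \<in> T \<and> (y, z) \<in> S)"
  by (auto simp: op_comp_def)

lemma adjoint_op_iff: "(g, h) \<in> adjoint_op T \<longleftrightarrow> (\<forall>f y. (f, y) \<in> T \<longrightarrow> cinner g y = cinner h f)"
  by (auto simp: adjoint_op_def)

section \<open>The operators \<open>A\<^sup>*A\<close> and \<open>|A|\<close>\<close>

locale coercive_closed_operator =
  fixes A :: "('a::chilbert_space, 'b::chilbert_space) graph" and \<epsilon> :: real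
  assumes subspace_A: "csubspace A" and sv_A: "single_valued A" and closed_A: "closed A"
    and dense_A: "closure (Domain A) = UNIV"
    and eps_pos: "\<epsilon> > 0" and coercive: "op_geq (adjoint_op A \<odot> A) \<epsilon>"
begin

abbreviation "T \<equiv> adjoint_op A \<odot> A"

section \<open>The adjoint and A*A as linear operators\<close>

lemma single_valued_adjoint: "single_valued (adjoint_op A)"
proof (rule single_valuedI)
  fix g h h' assume "(g, h) \<in> adjoint_op A" "(g, h') \<in> adjoint_op A"
  then have orth: "cinner (h - h') f = 0" if "f \<in> Domain A" for f
    using that by (auto simp: adjoint_op_iff cinner.diff_left)
  have "cinner (h - h') f = 0" for f
  proof -
    have "f \<in> closure (Domain A)" by (simp add: dense_A)
    then obtain u where "\<forall>n. u n \<in> Domain A" "u \<longlonglongrightarrow> f" unfolding closure_sequential by blast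
    then have "(\<lambda>n. cinner (h - h') (u n)) \<longlonglongrightarrow> cinner (h - h') f"
      by (intro cinner.tendsto tendsto_const)
    then show ?thesis using orth \<open>\<forall>n. u n \<in> Domain A\<close> by (simp add: LIMSEQ_const_iff)
  qed
  then have "cinner (h - h') (h - h') = 0" .
  then show "h = h'" by simp
qed

lemma csubspace_adjoint: "csubspace (adjoint_op A)"
  unfolding csubspace_iff
  by (auto simp: adjoint_op_iff zero_prod_def scaleC_Pair cinner.zero_left cinner_add_left
      cinner_scaleC_left)

lemma single_valued_T: "single_valued T"
  using sv_A single_valued_adjoint by (simp add: op_comp_def single_valued_relcomp)

lemma csubspace_T: "csubspace T"
  unfolding csubspace_iff
proof (intro conjI ballI allI)
  show "0 \<in> T"
    using graph_zero[OF subspace_A] graph_zero[OF csubspace_adjoint]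
    by (auto simp: zero_prod_def op_comp_iff)
  fix p assume "p \<in> T"
  then obtain f y h where p: "p = (f, h)" "(f, y) \<in> A" "(y, h) \<in> adjoint_op A"
    by (cases p) (auto simp: op_comp_iff)
  show "c *\<^sub>C p \<in> T" for c
    using p(1) graph_scaleC[OF subspace_A p(2)] graph_scaleC[OF csubspace_adjoint p(3)]
    by (auto simp: scaleC_Pair op_comp_iff)
  fix q assume "q \<in> T"
  then obtain f' y' h' where q: "q = (f', h')" "(f', y') \<in> A" "(y', h') \<in> adjoint_op A"
    by (cases q) (auto simp: op_comp_iff)
  show "p + q \<in> T"
    using p(1) q(1) graph_add[OF subspace_A p(2) q(2)] graph_add[OF csubspace_adjoint p(3) q(3)]
    by (auto simp: op_comp_iff)
qed

section \<open>The bounded inverse of A*A\<close>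

lemma T_form: "(f, h) \<in> T \<Longrightarrow> (f, y) \<in> A \<Longrightarrow> (g, z) \<in> A \<Longrightarrow> cinner h g = cinner y z"
  using sv_A by (auto simp: op_comp_iff adjoint_op_iff dest: single_valuedD)

lemma T_lower_bound: "(f, h) \<in> T \<Longrightarrow> \<epsilon> * (norm f)\<^sup>2 \<le> Re (cinner f h)"
  using coercive by (auto simp: op_geq_def)

text \<open>Project \<open>(x, 0)\<close> orthogonally onto the graph of \<open>A\<close>.\<close>

lemma T_plus_one_surj: "\<exists>f. (f, x - f) \<in> T"
proof -
  obtain m where "m \<in> A" and orth: "\<And>u. u \<in> A \<Longrightarrow> cinner ((x, 0) - m) u = 0"
    using orthogonal_projection_exists[OF subspace_A closed_A] by blast
  obtain f y where m: "m = (f, y)" by (cases m)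
  \<comment> \<open>Orthogonality to the graph is precisely the statement that the adjoint of
    \<open>A\<close> maps \<open>y\<close> to x - f.\<close>
  have "cinner y z = cinner (x - f) g" if "(g, z) \<in> A" for g z
    using orth[OF that] by (simp add: m cinner_Pair cinner.minus_left)
  then show ?thesis
    using \<open>m \<in> A\<close> by (auto simp: m op_comp_iff adjoint_op_iff)
qed

text \<open>By coercivity the inverse \<open>L\<close> of 1 + T is Lipschitz with constant 1 / (1 +
  \<epsilon>) < 1. The equation T f = x reads f = L (x + f), a Banach fixed point problem.\<close>

lemma T_surj: "\<exists>f. (f, x) \<in> T"
proof -
  obtain L where L: "(L u, u - L u) \<in> T" for u using T_plus_one_surj by metis
  have L_contr: "norm (L u - L v) \<le> 1 / (1 + \<epsilon>) * norm (u - v)" for u v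
  proof -
    let ?f = "L u - L v"
    have "(?f, (u - v) - ?f) \<in> T"
      using graph_diff[OF csubspace_T L L, of u v] by (simp add: algebra_simps)
    from T_lower_bound[OF this] have "(1 + \<epsilon>) * (norm ?f)\<^sup>2 \<le> Re (cinner ?f (u - v))"
      unfolding cinner.diff_right[of ?f "u - v"] by (simp add: Re_cinner_self distrib_right)
    also have "\<dots> \<le> norm ?f * norm (u - v)" by (rule Re_cinner_le)
    finally have "(1 + \<epsilon>) * norm ?f \<le> norm (u - v)"
      by (cases "?f = 0") (simp_all add: power2_eq_square)
    then show ?thesis using eps_pos by (simp add: field_simps)
  qed
  have "\<exists>!f. L (x + f) = f"
  proof (rule banach_fix_type)
    show "\<forall>f g. dist (L (x + f)) (L (x + g)) \<le> 1 / (1 + \<epsilon>) * dist f g"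
      using L_contr[of "x + _" "x + _"] by (simp add: dist_norm)
  qed (use eps_pos in auto)
  then obtain f where "L (x + f) = f" by blast
  with L[of "x + f"] show ?thesis by auto
qed

lemma T_inj: "(f, h) \<in> T \<Longrightarrow> (g, h) \<in> T \<Longrightarrow> f = g"
  using graph_diff[OF csubspace_T, of f h g h] T_lower_bound[of "f - g" 0] eps_pos
  by (simp add: cinner.zero_right mult_le_0_iff)

text \<open>Coercivity rewritten for the inverse is the form bound required by
  \<open>positive_sqrt_exists\<close>. Complex linearity is recorded separately because a bounded
  linear function is only real linear by type.\<close>

lemma T_inverse:
  obtains K :: "'a \<Rightarrow>\<^sub>L 'a" where "T = range (\<lambda>x. (K x, x))" "inj K" "symmetric_op K"
    "\<And>x. (norm (K x))\<^sup>2 \<le> 1 / \<epsilon> * Re (cinner x (K x))"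
    "\<And>c x. K (c *\<^sub>C x) = c *\<^sub>C K x"
proof -
  obtain k where k: "(k x, x) \<in> T" for x using T_surj by metis
  have k_eq: "(f, x) \<in> T \<Longrightarrow> k x = f" for f x using T_inj k by blast
  have k_add: "k (x + y) = k x + k y" for x y by (intro k_eq graph_add[OF csubspace_T] k)
  have k_scaleC: "k (c *\<^sub>C x) = c *\<^sub>C k x" for c x by (intro k_eq graph_scaleC[OF csubspace_T] k)
  have k_le: "\<epsilon> * (norm (k x))\<^sup>2 \<le> Re (cinner (k x) x)" for x by (rule T_lower_bound[OF k])
  have "norm (k x) \<le> norm x * (1 / \<epsilon>)" for x
  proof -
    have "\<epsilon> * (norm (k x))\<^sup>2 \<le> norm (k x) * norm x" using k_le Re_cinner_le order_trans by blast
    then have "\<epsilon> * norm (k x) \<le> norm x"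
      by (cases "k x = 0") (simp_all add: power2_eq_square)
    then show ?thesis using eps_pos by (simp add: field_simps)
  qed
  then have bl: "bounded_linear k"
    by (intro bounded_linear_intro[where K = "1 / \<epsilon>"]) (simp_all add: k_add scaleR_scaleC k_scaleC)
  have k_sym: "cinner (k x) y = cinner x (k y)" for x y
  proof -
    obtain a b where "(k x, a) \<in> A" "(k y, b) \<in> A" using k[of x] k[of y] by (auto simp: op_comp_iff)
    then have "cinner x (k y) = cinner a b" "cinner y (k x) = cinner b a" using T_form[OF k] by blast+
    then show ?thesis by (metis cinner_commute)
  qed
  show thesis
  proof
    show "T = range (\<lambda>x. (Blinfun k x, x))"
      using k k_eq by (force simp: bounded_linear_Blinfun_apply[OF bl])
    show "inj (Blinfun k)"
      unfolding bounded_linear_Blinfun_apply[OF bl]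
      using k single_valued_T by (intro injI) (metis single_valuedD)
    show "symmetric_op (Blinfun k)"
      by (simp add: bounded_linear_Blinfun_apply[OF bl] symmetric_op_def k_sym)
    show "(norm (Blinfun k x))\<^sup>2 \<le> 1 / \<epsilon> * Re (cinner x (Blinfun k x))" for x
      using k_le[of x] eps_pos
      by (simp add: bounded_linear_Blinfun_apply[OF bl] k_sym field_simps)
    show "Blinfun k (c *\<^sub>C x) = c *\<^sub>C Blinfun k x" for c x
      by (simp add: bounded_linear_Blinfun_apply[OF bl] k_scaleC)
  qed
qed

section \<open>Existence, uniqueness and domain of |A|\<close>

lemma dense_range_symmetric:
  fixes C :: "'a \<Rightarrow>\<^sub>L 'a"
  assumes "inj C" "symmetric_op C" "\<And>c x. C (c *\<^sub>C x) = c *\<^sub>C C x"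
  shows "closure (range C) = UNIV"
proof (rule dense_csubspaceI)
  show "csubspace (range C)"
    unfolding csubspace_iff
    by (auto intro: range_eqI[of _ _ 0] range_eqI[of _ _ "x + y" for x y]
        range_eqI[of _ _ "c *\<^sub>C x" for c x] simp: blinfun.bilinear_simps assms(3))
  fix y assume y: "\<And>x. x \<in> range C \<Longrightarrow> cinner y x = 0"
  have "cinner (C y) (C y) = 0"
    using y[of "C (C y)"] symmetric_opD[OF assms(2), of y "C y"] by simp
  then show "y = 0"
    using injD[OF assms(1), of y 0] by (simp add: blinfun.zero_right)
qed

text \<open>The description in \<open>op_sqrt\<close> needs uniqueness among all nonnegative
  self-adjoint operators, bounded or not. Since \<open>T\<close> is bijective, any such root
  \<open>S\<close> is bijective too, and its inverse \<open>d\<close> is a bounded positive root of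
  \<open>K\<close>.\<close>

lemma op_abs_eq:
  fixes C K :: "'a \<Rightarrow>\<^sub>L 'a"
  assumes T: "T = range (\<lambda>x. (K x, x))" and "inj K"
    and K_le: "\<And>x. (norm (K x))\<^sup>2 \<le> 1 / \<epsilon> * Re (cinner x (K x))"
    and sq: "C o\<^sub>L C = K" and symC: "symmetric_op C" and posC: "positive_op C"
    and linC: "\<And>c x. C (c *\<^sub>C x) = c *\<^sub>C C x"
    and commC: "\<And>D. D o\<^sub>L K = K o\<^sub>L D \<Longrightarrow> D o\<^sub>L C = C o\<^sub>L D"
  shows "op_abs A = range (\<lambda>x. (C x, x))"
  unfolding op_abs_def op_sqrt_def
proof (rule the_equality)
  let ?B = "range (\<lambda>x. (C x, x))"
  have CC: "C (C x) = K x" for x using sq by auto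
  have injC: "inj C" using CC \<open>inj K\<close> by (metis injD injI)
  have "csubspace ?B"
    unfolding csubspace_iff
    by (auto intro: range_eqI[of _ _ 0] range_eqI[of _ _ "x + y" for x y]
        range_eqI[of _ _ "c *\<^sub>C x" for c x]
        simp: zero_prod_def scaleC_Pair blinfun.bilinear_simps linC)
  moreover have "single_valued ?B" using injC by (auto intro!: single_valuedI dest: injD)
  moreover have "closure (Domain ?B) = UNIV"
    using dense_range_symmetric[OF injC symC linC] by (simp add: Domain_fst image_image)
  moreover have "adjoint_op ?B = ?B"
  proof -
    \<comment> \<open>Membership says that \<open>g\<close> and \<open>C h\<close> have the same
      scalar product with every vector; thus the inverse of a bounded symmetric injection is
      self-adjoint.\<close>
    have "(g, h) \<in> adjoint_op ?B \<longleftrightarrow> g = C h" for g h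
      using symmetric_opD[OF symC, of h] by (auto simp: adjoint_op_iff intro: cinner_eqI)
    then show ?thesis by auto
  qed
  moreover have "op_geq ?B 0"
    using posC symmetric_opD[OF symC] by (auto simp: op_geq_def positive_op_def)
  moreover have "?B \<odot> ?B = T"
    unfolding T by (auto simp: op_comp_def relcomp_unfold image_iff simp flip: CC)
  ultimately show "self_adjoint ?B \<and> op_geq ?B 0 \<and> ?B \<odot> ?B = T"
    by (simp add: self_adjoint_def linear_op_univ_space densely_defined_univ_space)
next
  fix S assume S: "self_adjoint S \<and> op_geq S 0 \<and> S \<odot> S = T"
  then have sub: "csubspace S" and adj: "adjoint_op S = S" and pos: "op_geq S 0" and SS: "S \<odot> S = T"
    by (simp_all add: self_adjoint_def linear_op_univ_space)
  have T_iff: "(f, h) \<in> T \<longleftrightarrow> f = K h" for f h unfolding T by auto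
  have kernel: "f = 0" if "(f, 0) \<in> S" for f
  proof -
    have "(f, 0) \<in> S \<odot> S" unfolding op_comp_iff using that graph_zero[OF sub] by blast
    then show ?thesis by (simp add: SS T_iff blinfun.zero_right)
  qed
  have inj: "f = g" if "(f, h) \<in> S" "(g, h) \<in> S" for f g h
    using kernel[of "f - g"] graph_diff[OF sub that] by simp
  have "\<exists>g. (g, h) \<in> S" for h
  proof -
    have "(K h, h) \<in> S \<odot> S" by (simp add: SS T_iff)
    then show ?thesis unfolding op_comp_iff by blast
  qed
  then obtain d where d: "(d h, h) \<in> S" for h by metis
  have d_eq: "(f, h) \<in> S \<Longrightarrow> d h = f" for f h using inj d by blast
  have dd: "d (d h) = K h" for h
  proof -
    have "(d (d h), h) \<in> S \<odot> S" unfolding op_comp_iff using d by blast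
    then show ?thesis by (simp add: SS T_iff)
  qed
  have d_sym: "cinner (d x) y = cinner x (d y)" for x y
    using d[of x] d[of y] adj adjoint_op_iff[of "d x" x S] by simp
  \<comment> \<open>Boundedness of \<open>d\<close> comes from its square: the squared norm of
    \<open>d x\<close> is the form of \<open>K\<close> at \<open>x\<close>.\<close>
  have "(norm (d x))\<^sup>2 \<le> (norm x * sqrt (norm K))\<^sup>2" for x
  proof -
    have "(norm (d x))\<^sup>2 = Re (cinner x (K x))"
      unfolding Re_cinner_self[symmetric] d_sym dd ..
    also have "\<dots> \<le> norm x * (norm K * norm x)"
      by (intro order_trans[OF Re_cinner_le] mult_left_mono norm_blinfun norm_ge_zero)
    finally show ?thesis by (simp add: power_mult_distrib power2_eq_square algebra_simps)
  qed
  then have "norm (d x) \<le> norm x * sqrt (norm K)" for x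
    by (rule power2_le_imp_le) simp
  then have bl: "bounded_linear d"
    by (intro bounded_linear_intro[where K = "sqrt (norm K)"])
      (auto intro!: d_eq graph_add[OF sub] graph_scaleR[OF sub] d)
  have D: "blinfun_apply (Blinfun d) = d" by (rule bounded_linear_Blinfun_apply[OF bl])
  have "C = Blinfun d"
  proof (rule positive_sqrt_unique[OF symC posC])
    show "symmetric_op (Blinfun d)" by (simp add: D symmetric_op_def d_sym)
    show "positive_op (Blinfun d)"
      using pos d by (auto simp: D positive_op_def op_geq_def simp flip: d_sym)
    show "C o\<^sub>L C = Blinfun d o\<^sub>L Blinfun d"
      by (rule blinfun_eqI) (simp add: sq D dd)
    \<comment> \<open>Automatic because \<open>K\<close> is the square of \<open>d\<close>; it
      passes to \<open>C\<close> and yields the commutation needed for uniqueness.\<close>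
    have "Blinfun d o\<^sub>L K = K o\<^sub>L Blinfun d"
      by (rule blinfun_eqI) (simp add: D flip: dd)
    then show "C o\<^sub>L Blinfun d = Blinfun d o\<^sub>L C" using commC by simp
  qed
  then show "S = range (\<lambda>x. (C x, x))"
    using d d_eq by (force simp: D)
qed

text \<open>The last two facts state that |A| and \<open>A\<close> have the same domain and the same
  scalar products of values, written on ran C, where |A| C x = x.\<close>

theorem op_abs_structure:
  obtains C :: "'a \<Rightarrow>\<^sub>L 'a" where
    "op_abs A = range (\<lambda>x. (C x, x))" "T = range (\<lambda>x. (C (C x), x))"
    "inj C" "symmetric_op C" "\<And>c x. C (c *\<^sub>C x) = c *\<^sub>C C x"
    "closure (range C) = UNIV" "Domain A = range C"
    "\<And>x y. cinner (app A (C x)) (app A (C y)) = cinner x y"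
proof -
  obtain K :: "'a \<Rightarrow>\<^sub>L 'a" where K: "T = range (\<lambda>x. (K x, x))" "inj K" "symmetric_op K"
    "\<And>x. (norm (K x))\<^sup>2 \<le> 1 / \<epsilon> * Re (cinner x (K x))" "\<And>c x. K (c *\<^sub>C x) = c *\<^sub>C K x"
    by (rule T_inverse, rule that) (assumption | blast)+
  have "1 / \<epsilon> > 0" using eps_pos by simp
  obtain C where C: "C o\<^sub>L C = K" "symmetric_op C" "positive_op C"
    "\<And>D. D o\<^sub>L K = K o\<^sub>L D \<Longrightarrow> D o\<^sub>L C = C o\<^sub>L D"
    by (rule positive_sqrt_exists[OF K(3) \<open>1 / \<epsilon> > 0\<close> K(4)], rule that) (assumption | blast)+
  have CC: "C (C x) = K x" for x using C(1) by auto
  have injC: "inj C" using CC K(2) by (metis injD injI)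
  have linC: "C (c *\<^sub>C x) = c *\<^sub>C C x" for c x
  proof -
    \<comment> \<open>Multiplication by \<open>c\<close> is itself a bounded real linear operator
      commuting with \<open>K\<close>, so it commutes with the root.\<close>
    let ?D = "Blinfun (\<lambda>x :: 'a. c *\<^sub>C x)"
    have D: "blinfun_apply ?D = (\<lambda>x. c *\<^sub>C x)"
      by (rule bounded_linear_Blinfun_apply[OF bounded_linear_scaleC])
    have "?D o\<^sub>L K = K o\<^sub>L ?D" by (rule blinfun_eqI) (simp add: D K(5))
    then have "(?D o\<^sub>L C) x = (C o\<^sub>L ?D) x" using C(4) by simp
    then show ?thesis by (simp add: D)
  qed
  have dense: "closure (range C) = UNIV" by (rule dense_range_symmetric[OF injC C(2) linC])
  have AK: "(K v, app A (K v)) \<in> A" for v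
  proof -
    have "(K v, v) \<in> T" using K(1) by auto
    then have "K v \<in> Domain A" by (auto simp: op_comp_iff)
    then show ?thesis by (rule app_mem[OF sv_A])
  qed
  have form: "cinner (app A (K v)) z = cinner v g" if "(g, z) \<in> A" for v g z
    using T_form[OF _ AK that, of v v] K(1) by auto
  \<comment> \<open>Isometry of A C on the vectors C v only, where C (C v) = K v lies in the domain
    of \<open>T\<close> and the form identity is available.\<close>
  have AK_iso: "cinner (app A (K v)) (app A (K w)) = cinner (C v) (C w)" for v w
    using form[OF AK] symmetric_opD[OF C(2), of v "C w"] by (simp add: CC)
  have AK_dist: "norm (app A (K v) - app A (K w)) = norm (C v - C w)" for v w
  proof -
    have "app A (K v) - app A (K w) = app A (K (v - w))"
      using graph_diff[OF subspace_A AK AK, of v w] app_eqI[OF sv_A]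
      by (simp add: blinfun.bilinear_simps)
    moreover have "(norm (app A (K (v - w))))\<^sup>2 = (norm (C (v - w)))\<^sup>2"
      by (simp add: AK_iso flip: Re_cinner_self)
    ultimately show ?thesis by (simp add: blinfun.bilinear_simps)
  qed
  \<comment> \<open>The vectors C v are dense, their images under A C form Cauchy sequences by
    \<open>AK_dist\<close>, and closedness of \<open>A\<close> puts the limit into its graph. Thus
    all of ran C lies in dom A.\<close>
  have approx: "\<exists>v z. (\<lambda>n. C (v n)) \<longlonglongrightarrow> x \<and> (\<lambda>n. app A (K (v n))) \<longlonglongrightarrow> z \<and> (C x, z) \<in> A" for x
  proof -
    have "x \<in> closure (range C)" by (simp add: dense)
    then obtain u where u: "\<And>n. u n \<in> range C" "u \<longlonglongrightarrow> x" unfolding closure_sequential by blast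
    then have "\<exists>v. \<forall>n. u n = C (v n)" by (intro choice) (auto simp: image_iff)
    then obtain v where "\<And>n. u n = C (v n)" by blast
    then have v: "(\<lambda>n. C (v n)) \<longlonglongrightarrow> x" using u(2) by presburger
    then have "Cauchy (\<lambda>n. C (v n))" by (rule LIMSEQ_imp_Cauchy)
    then have "Cauchy (\<lambda>n. app A (K (v n)))" by (simp add: Cauchy_def dist_norm AK_dist)
    then obtain z where z: "(\<lambda>n. app A (K (v n))) \<longlonglongrightarrow> z"
      using Cauchy_convergent convergent_def by blast
    have "(\<lambda>n. (K (v n), app A (K (v n)))) \<longlonglongrightarrow> (C x, z)"
      by (intro tendsto_Pair z) (simp flip: CC, intro tendsto_intros v)
    then have "(C x, z) \<in> A" by (rule closed_sequentially[OF closed_A, rotated]) (rule AK)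
    with v z show ?thesis by blast
  qed
  have AC: "(C x, app A (C x)) \<in> A" for x using approx[of x] app_eqI[OF sv_A] by metis
  have iso: "cinner (app A (C x)) (app A (C y)) = cinner x y" for x y
  proof -
    obtain v z where v: "(\<lambda>n. C (v n)) \<longlonglongrightarrow> x" "(\<lambda>n. app A (K (v n))) \<longlonglongrightarrow> z" "(C x, z) \<in> A"
      using approx by metis
    obtain w z' where w: "(\<lambda>n. C (w n)) \<longlonglongrightarrow> y" "(\<lambda>n. app A (K (w n))) \<longlonglongrightarrow> z'" "(C y, z') \<in> A"
      using approx by metis
    have "(\<lambda>n. cinner (C (v n)) (C (w n))) \<longlonglongrightarrow> cinner z z'"
      unfolding AK_iso[symmetric] by (intro cinner.tendsto v w)
    moreover have "(\<lambda>n. cinner (C (v n)) (C (w n))) \<longlonglongrightarrow> cinner x y" by (intro cinner.tendsto v w)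
    ultimately show ?thesis
      using v(3) w(3) app_eqI[OF sv_A] LIMSEQ_unique by metis
  qed
  have "Domain A \<subseteq> range C"
  proof
    fix f assume "f \<in> Domain A"
    then obtain a where a: "(f, a) \<in> A" by blast
    \<comment> \<open>Split \<open>a\<close> along the range of the isometry \<open>W = A C\<close>.\<close>
    let ?W = "\<lambda>x. app A (C x)"
    have W_add: "?W (x + y) = ?W x + ?W y" and W_diff: "?W (x - y) = ?W x - ?W y"
      and W_scaleC: "?W (c *\<^sub>C x) = c *\<^sub>C ?W x" for x y c
      by (auto simp: blinfun.bilinear_simps linC intro!: app_eqI[OF sv_A] graph_add[OF subspace_A]
          graph_diff[OF subspace_A] graph_scaleC[OF subspace_A] AC)
    have W_norm: "norm (?W x) = norm x" for x
    proof -
      have "(norm (?W x))\<^sup>2 = (norm x)\<^sup>2" by (simp add: iso flip: Re_cinner_self)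
      then show ?thesis by simp
    qed
    have "csubspace (range ?W)"
      unfolding csubspace_iff
    proof (intro conjI ballI allI)
      show "0 \<in> range ?W" using W_norm[of 0] by (intro range_eqI[of _ _ 0]) simp
    qed (auto simp flip: W_add W_scaleC)
    moreover have "closed (range ?W)"
      unfolding closed_sequential_limits
    proof (intro allI impI, elim conjE)
      fix y l assume "\<forall>n. y n \<in> range ?W" and l: "y \<longlonglongrightarrow> l"
      then have "\<exists>x. \<forall>n. y n = ?W (x n)" by (intro choice) (auto simp: image_iff)
      then obtain x where x: "\<And>n. y n = ?W (x n)" by blast
      have "Cauchy y" using l by (rule LIMSEQ_imp_Cauchy)
      then have "Cauchy x" by (simp add: Cauchy_def dist_norm x W_norm flip: W_diff)
      then obtain p where p: "x \<longlonglongrightarrow> p" using Cauchy_convergent convergent_def by blast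
      have "(\<lambda>n. norm (y n - ?W p)) \<longlonglongrightarrow> 0"
        using p by (simp add: x W_norm LIM_zero_iff tendsto_norm_zero_iff flip: W_diff)
      then have "y \<longlonglongrightarrow> ?W p" by (simp add: tendsto_norm_zero_iff LIM_zero_iff)
      then show "l \<in> range ?W" using l LIMSEQ_unique by blast
    qed
    ultimately obtain r where "r \<in> range ?W" and r: "\<And>u. u \<in> range ?W \<Longrightarrow> cinner (a - r) u = 0"
      using orthogonal_projection_exists by blast
    then obtain h where h: "r = ?W h" by blast
    \<comment> \<open>The left side is the scalar product of A K v with a - r, and A K v = ?W (C v)
      lies in the range to which a - r is orthogonal.\<close>
    have "cinner v (f - C h) = 0" for v
    proof -
      have "(f - C h, a - r) \<in> A" unfolding h by (rule graph_diff[OF subspace_A a AC])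
      then have "cinner v (f - C h) = cinner (app A (K v)) (a - r)" by (simp add: form)
      also have "\<dots> = 0"
        using r[OF rangeI, of "C v"] cinner_eq_zero_commute[of "a - r" "?W (C v)"] by (simp add: CC)
      finally show ?thesis .
    qed
    then have "f - C h = 0" using cinner_self_eq_zero by blast
    then show "f \<in> range C" by simp
  qed
  moreover have "range C \<subseteq> Domain A" using AC by blast
  ultimately have dom: "Domain A = range C" ..
  show thesis
  proof
    show "op_abs A = range (\<lambda>x. (C x, x))" by (rule op_abs_eq[OF K(1,2,4) C(1-3) linC C(4)])
    show "T = range (\<lambda>x. (C (C x), x))" by (simp add: CC K(1))
  qed (fact injC C(2) linC dense dom iso)+
qed

end

section \<open>Generation of contraction semigroups\<close>

lemma contractions_convergent_from_dense:
  fixes F :: "nat \<Rightarrow> 'a::real_normed_vector \<Rightarrow> 'b::banach"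
  assumes dense: "closure D = UNIV"
    and conv: "\<And>x. x \<in> D \<Longrightarrow> convergent (\<lambda>n. F n x)"
    and contr: "\<And>n x y. norm (F n x - F n y) \<le> norm (x - y)"
  shows "convergent (\<lambda>n. F n x)"
proof -
  have "Cauchy (\<lambda>n. F n x)"
  proof (rule metric_CauchyI)
    fix e :: real assume "e > 0"
    have "x \<in> closure D" by (simp add: dense)
    then obtain y where "y \<in> D" and y: "norm (y - x) < e / 3"
      using \<open>e > 0\<close> unfolding closure_approachable dist_norm by (metis zero_less_divide_iff zero_less_numeral)
    have "Cauchy (\<lambda>n. F n y)" using conv[OF \<open>y \<in> D\<close>] by (simp add: convergent_Cauchy)
    then obtain M where M: "\<And>m n. m \<ge> M \<Longrightarrow> n \<ge> M \<Longrightarrow> norm (F m y - F n y) < e / 3"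
      using \<open>e > 0\<close> unfolding Cauchy_def dist_norm by (metis zero_less_divide_iff zero_less_numeral)
    have "dist (F m x) (F n x) < e" if "m \<ge> M" "n \<ge> M" for m n
    proof -
      have "norm (F m x - F n x)
          \<le> norm (F m y - F n y) + norm (F m x - F m y) + norm (F n y - F n x)"
        using norm_triangle_ineq[of "F m y - F n y + (F m x - F m y)" "F n y - F n x"]
          norm_triangle_ineq[of "F m y - F n y" "F m x - F m y"] by simp
      also have "\<dots> < e"
        using M[OF that] contr[of m x y] contr[of n y x] y norm_minus_commute[of x y] by linarith
      finally show ?thesis by (simp add: dist_norm)
    qed
    then show "\<exists>M. \<forall>m\<ge>M. \<forall>n\<ge>M. dist (F m x) (F n x) < e" by blast
  qed
  then show ?thesis by (rule Cauchy_convergent)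
qed

section \<open>Resolvents of a dissipative operator\<close>

locale maximal_dissipative =
  fixes N :: "('a::chilbert_space, 'a) graph"
  assumes subspace_N: "csubspace N"
    and dense_N: "closure (Domain N) = UNIV"
    and dissipative: "(x, y) \<in> N \<Longrightarrow> Re (cinner x y) \<le> 0"
    and range_condition: "\<exists>\<mu>>0. \<forall>y. \<exists>x. (x, \<mu> *\<^sub>R x - y) \<in> N"
begin

text \<open>The hypothesis reads (\<mu> - N) x = y, the form in which resolvent equations are
  written throughout.\<close>

lemma resolvent_norm_le:
  assumes "(x, \<mu> *\<^sub>R x - y) \<in> N"
  shows "\<mu> * norm x \<le> norm y"
proof (cases "x = 0")
  case False
  have "\<mu> * (norm x)\<^sup>2 \<le> Re (cinner x y)"
    using dissipative[OF assms] by (simp add: cinner.diff_right cinner_scaleR_right Re_cinner_self)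
  also have "\<dots> \<le> norm x * norm y" by (rule Re_cinner_le)
  finally show ?thesis using False by (simp add: power2_eq_square)
qed simp

text \<open>With \<open>L\<close> the inverse of \<mu> - N, the equation (\<nu> - N) x = y is the
  fixed point equation x = L (y + (\<mu> - \<nu>) x), whose Lipschitz constant is |\<nu> - \<mu>| /
  \<mu>.\<close>

lemma range_condition_near:
  assumes "\<mu> > 0" and range: "\<And>y. \<exists>x. (x, \<mu> *\<^sub>R x - y) \<in> N" and near: "\<bar>\<nu> - \<mu>\<bar> < \<mu>"
  shows "\<exists>x. (x, \<nu> *\<^sub>R x - y) \<in> N"
proof -
  obtain L where L: "(L y, \<mu> *\<^sub>R L y - y) \<in> N" for y using range by metis
  have L_le: "norm (L u - L v) \<le> norm (u - v) / \<mu>" for u v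
  proof -
    have "(L u - L v, \<mu> *\<^sub>R (L u - L v) - (u - v)) \<in> N"
      using graph_diff[OF subspace_N L L, of u v] by (simp add: algebra_simps)
    from resolvent_norm_le[OF this] show ?thesis
      using \<open>\<mu> > 0\<close> by (simp add: pos_le_divide_eq mult.commute)
  qed
  have "\<exists>!x. L (y + (\<mu> - \<nu>) *\<^sub>R x) = x"
  proof (rule banach_fix_type)
    show "\<forall>u v. dist (L (y + (\<mu> - \<nu>) *\<^sub>R u)) (L (y + (\<mu> - \<nu>) *\<^sub>R v)) \<le> \<bar>\<nu> - \<mu>\<bar> / \<mu> * dist u v"
    proof (intro allI)
      fix u v
      have "dist (L (y + (\<mu> - \<nu>) *\<^sub>R u)) (L (y + (\<mu> - \<nu>) *\<^sub>R v))
          \<le> norm ((\<mu> - \<nu>) *\<^sub>R (u - v)) / \<mu>"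
        using L_le[of "y + (\<mu> - \<nu>) *\<^sub>R u" "y + (\<mu> - \<nu>) *\<^sub>R v"]
        by (simp add: dist_norm scaleR_diff_right)
      then show "dist (L (y + (\<mu> - \<nu>) *\<^sub>R u)) (L (y + (\<mu> - \<nu>) *\<^sub>R v)) \<le> \<bar>\<nu> - \<mu>\<bar> / \<mu> * dist u v"
        by (simp add: dist_norm abs_minus_commute)
    qed
  qed (use assms in auto)
  then obtain x where "L (y + (\<mu> - \<nu>) *\<^sub>R x) = x" by blast
  with L[of "y + (\<mu> - \<nu>) *\<^sub>R x"] show ?thesis by (auto simp: algebra_simps)
qed

lemma range_condition_all:
  assumes "\<nu> > 0"
  shows "\<exists>x. (x, \<nu> *\<^sub>R x - y) \<in> N"
proof -
  obtain \<mu> where "\<mu> > 0" and \<mu>: "\<And>y. \<exists>x. (x, \<mu> *\<^sub>R x - y) \<in> N"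
    using range_condition by blast
  \<comment> \<open>From \<mu> every \<nu> with 0 < \<nu> < 2 \<mu> is reachable. A factor 3 / 2 per
    move stays in this range and eventually passes \<nu>; a single move down then reaches
    it.\<close>
  have pow: "\<exists>x. (x, (\<mu> * (3 / 2) ^ n) *\<^sub>R x - y) \<in> N" for n y
  proof (induction n arbitrary: y)
    case (Suc n)
    show ?case
      by (rule range_condition_near[OF _ Suc]) (use \<open>\<mu> > 0\<close> in \<open>auto simp: algebra_simps\<close>)
  qed (use \<mu> in simp)
  obtain n where "\<nu> / \<mu> < (3 / 2) ^ n" using real_arch_pow[of "3 / 2" "\<nu> / \<mu>"] by auto
  then have "\<nu> < \<mu> * (3 / 2) ^ n" using \<open>\<mu> > 0\<close> by (simp add: field_simps)
  then show ?thesis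
    using \<open>\<nu> > 0\<close> \<open>\<mu> > 0\<close> by (intro range_condition_near[OF _ pow[of n]]) auto
qed

text \<open>The resolvent (1 - h N)^-1, one implicit Euler step. The choice is among a single
  candidate for h > 0, by \<open>J_eqI\<close>.\<close>

definition J :: "real \<Rightarrow> 'a \<Rightarrow> 'a"
  where "J h y = (SOME x. (x, (1 / h) *\<^sub>R (x - y)) \<in> N)"

context
  fixes h :: real
  assumes h: "h > 0"
begin

lemma J_graph: "(J h y, (1 / h) *\<^sub>R (J h y - y)) \<in> N"
proof -
  have "\<exists>x. (x, (1 / h) *\<^sub>R x - (1 / h) *\<^sub>R y) \<in> N" using h by (intro range_condition_all) simp
  then have "\<exists>x. (x, (1 / h) *\<^sub>R (x - y)) \<in> N" by (simp add: scaleR_diff_right)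
  then show ?thesis unfolding J_def by (rule someI_ex)
qed

text \<open>Uniqueness from the resolvent bound; the algebraic rules for \<open>J\<close> reduce to
  exhibiting a solution.\<close>

lemma J_eqI:
  assumes "(x, z) \<in> N" and "x - y = h *\<^sub>R z"
  shows "J h y = x"
proof -
  have "(1 / h) *\<^sub>R (J h y - y) - z = (1 / h) *\<^sub>R (J h y - x) - 0"
    using assms(2) h by (simp add: algebra_simps)
  then have "(J h y - x, (1 / h) *\<^sub>R (J h y - x) - 0) \<in> N"
    using graph_diff[OF subspace_N J_graph assms(1), of y] by metis
  from resolvent_norm_le[OF this] show ?thesis using h by (simp add: divide_le_0_iff)
qed

lemma J_add: "J h (x + y) = J h x + J h y"
  by (rule J_eqI[OF graph_add[OF subspace_N J_graph J_graph]]) (use h in \<open>simp add: algebra_simps\<close>)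

lemma J_diff: "J h (x - y) = J h x - J h y"
  by (rule J_eqI[OF graph_diff[OF subspace_N J_graph J_graph]]) (use h in \<open>simp add: algebra_simps\<close>)

lemma J_scaleC: "J h (c *\<^sub>C x) = c *\<^sub>C J h x"
  by (rule J_eqI[OF graph_scaleC[OF subspace_N J_graph]])
    (use h in \<open>simp add: scaleC_scaleR_commute scaleC_diff_right\<close>)

lemma J_scaleR: "J h (r *\<^sub>R x) = r *\<^sub>R J h x"
  by (simp add: scaleR_scaleC J_scaleC)

lemma J_contraction: "norm (J h y) \<le> norm y"
proof -
  have "(J h y, (1 / h) *\<^sub>R J h y - (1 / h) *\<^sub>R y) \<in> N"
    using J_graph[of y] by (simp add: scaleR_diff_right)
  from resolvent_norm_le[OF this] show ?thesis using h by (simp add: divide_le_cancel)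
qed

text \<open>The vector x + h J z solves the equation that defines J x, and \<open>N\<close> maps it
  to J z.\<close>

lemma J_commute:
  assumes "(x, z) \<in> N"
  shows "(J h x, J h z) \<in> N" and "J h x - x = h *\<^sub>R J h z"
proof -
  have "h *\<^sub>R ((1 / h) *\<^sub>R (J h z - z)) = J h z - z" using h by simp
  then have "z + h *\<^sub>R ((1 / h) *\<^sub>R (J h z - z)) = J h z" by simp
  then have g: "(x + h *\<^sub>R J h z, J h z) \<in> N"
    using graph_add[OF subspace_N assms graph_scaleR[OF subspace_N J_graph[of z], of h]] by metis
  then have "J h x = x + h *\<^sub>R J h z" by (rule J_eqI) simp
  with g show "(J h x, J h z) \<in> N" "J h x - x = h *\<^sub>R J h z" by simp_all
qed

lemma J_pow_add: "(J h ^^ m) (x + y) = (J h ^^ m) x + (J h ^^ m) y"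
  by (induction m) (simp_all add: J_add)

lemma J_pow_diff: "(J h ^^ m) (x - y) = (J h ^^ m) x - (J h ^^ m) y"
  by (induction m) (simp_all add: J_diff)

lemma J_pow_scaleC: "(J h ^^ m) (c *\<^sub>C x) = c *\<^sub>C (J h ^^ m) x"
  by (induction m) (simp_all add: J_scaleC)

lemma J_pow_scaleR: "(J h ^^ m) (r *\<^sub>R x) = r *\<^sub>R (J h ^^ m) x"
  by (induction m) (simp_all add: J_scaleR)

lemma J_pow_contraction: "norm ((J h ^^ m) x) \<le> norm x"
  by (induction m) (auto intro: order_trans[OF J_contraction])

lemma J_pow_graph: "(x, z) \<in> N \<Longrightarrow> ((J h ^^ m) x, (J h ^^ m) z) \<in> N"
  by (induction m) (simp_all add: J_commute(1))

lemma J_near_identity: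
  assumes "(x, z) \<in> N"
  shows "norm (J h x - x) \<le> h * norm z"
  using J_commute(2)[OF assms] J_contraction[of z] h by (simp add: mult_left_mono)

lemma J_pow_near_identity:
  assumes "(x, z) \<in> N"
  shows "norm ((J h ^^ m) x - x) \<le> m * h * norm z"
proof (induction m)
  case (Suc m)
  have "norm ((J h ^^ Suc m) x - x) \<le> norm (J h ((J h ^^ m) x - x)) + norm (J h x - x)"
    using norm_triangle_ineq[of "J h ((J h ^^ m) x - x)" "J h x - x"] by (simp add: J_diff)
  also have "\<dots> \<le> m * h * norm z + h * norm z"
    by (intro add_mono order_trans[OF J_contraction] Suc.IH J_near_identity assms)
  finally show ?case by (simp add: algebra_simps)
qed simp

text \<open>Each further step adds h times a power of \<open>J\<close> applied to \<open>z\<close>,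
  which differs from h z by a first-order error in \<open>w\<close>. Summing these errors gives a
  Taylor remainder; the constant is generous.\<close>

lemma J_pow_second_order:
  assumes "(x, z) \<in> N" "(z, w) \<in> N"
  shows "norm ((J h ^^ m) x - x - (m * h) *\<^sub>R z) \<le> (m * h)\<^sup>2 * norm w"
proof (induction m)
  case (Suc m)
  have "(J h ^^ Suc m) x - x - (Suc m * h) *\<^sub>R z
      = ((J h ^^ m) x - x - (m * h) *\<^sub>R z) + ((J h ^^ m) (J h x - x) - h *\<^sub>R z)"
    by (simp add: J_pow_diff funpow_swap1 algebra_simps)
  also have "(J h ^^ m) (J h x - x) = h *\<^sub>R (J h ^^ Suc m) z"
    by (simp add: J_commute(2)[OF assms(1)] J_pow_scaleR funpow_swap1)
  also have "\<dots> - h *\<^sub>R z = h *\<^sub>R ((J h ^^ Suc m) z - z)" by (simp add: scaleR_diff_right)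
  also have "norm (((J h ^^ m) x - x - (m * h) *\<^sub>R z) + h *\<^sub>R ((J h ^^ Suc m) z - z))
      \<le> (m * h)\<^sup>2 * norm w + h * (Suc m * h * norm w)"
  proof (intro order_trans[OF norm_triangle_ineq] add_mono Suc.IH)
    show "norm (h *\<^sub>R ((J h ^^ Suc m) z - z)) \<le> h * (Suc m * h * norm w)"
      using J_pow_near_identity[OF assms(2), of "Suc m"] h
      by (simp only: norm_scaleR) (simp add: mult_left_mono del: funpow.simps)
  qed
  also have "\<dots> = (real m ^ 2 + Suc m) * (h\<^sup>2 * norm w)"
    by (simp add: power2_eq_square algebra_simps)
  also have "\<dots> \<le> (real (Suc m) ^ 2) * (h\<^sup>2 * norm w)"
    by (intro mult_right_mono mult_nonneg_nonneg) (simp_all add: power2_eq_square algebra_simps)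
  also have "\<dots> = (Suc m * h)\<^sup>2 * norm w" by (simp add: power_mult_distrib)
  finally show ?case .
qed simp

end

text \<open>From \<open>(1 - kN)\<^sup>2 = 1 - 2kN + k\<^sup>2N\<^sup>2\<close>, two steps of length \<open>k\<close> and one step of length \<open>2k\<close>
  differ by \<open>k\<^sup>2 J\<^sub>2\<^sub>k J\<^sub>k\<^sup>2 N\<^sup>2\<close>.\<close>

lemma J_halving:
  assumes k: "k > 0" and N: "(x, z) \<in> N" "(z, w) \<in> N"
  shows "norm (J (2 * k) x - J k (J k x)) \<le> k\<^sup>2 * norm w"
proof -
  have k2: "2 * k > 0" using k by simp
  have x: "J k x - x = k *\<^sub>R J k z" and z: "J k z - z = k *\<^sub>R J k w"
    by (rule J_commute(2)[OF k N(1)], rule J_commute(2)[OF k N(2)])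
  let ?q = "J k (J k x)" and ?p = "J k (J k z)" and ?r = "J k (J k w)"
  have zz: "?p - J k z = k *\<^sub>R ?r"
    using arg_cong[OF z, of "J k"] by (simp add: J_diff[OF k] J_scaleR[OF k])
  have xx: "?q - J k x = k *\<^sub>R ?p"
    using arg_cong[OF x, of "J k"] by (simp add: J_diff[OF k] J_scaleR[OF k])
  have "?q = x + k *\<^sub>R J k z + k *\<^sub>R ?p" using x xx by (simp add: algebra_simps)
  moreover have "J k z = ?p - k *\<^sub>R ?r" using zz by (simp add: algebra_simps)
  ultimately have "?q = x + k *\<^sub>R (?p - k *\<^sub>R ?r) + k *\<^sub>R ?p" by metis
  \<comment> \<open>Since \<open>N\<close> maps ?q to ?p, this says that ?q is one step of length 2
    k from a point that differs from \<open>x\<close> by second order.\<close>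
  then have eq: "?q - (x - k\<^sup>2 *\<^sub>R ?r) = (2 * k) *\<^sub>R ?p"
    by (simp add: algebra_simps power2_eq_square flip: scaleR_2)
  have "(?q, ?p) \<in> N" by (intro J_commute(1) k N(1))
  from J_eqI[OF k2 this eq] have "?q = J (2 * k) x - k\<^sup>2 *\<^sub>R J (2 * k) ?r"
    by (simp add: J_diff[OF k2] J_scaleR[OF k2])
  then have "norm (J (2 * k) x - ?q) = k\<^sup>2 * norm (J (2 * k) ?r)" by simp
  also have "\<dots> \<le> k\<^sup>2 * norm w"
    by (intro mult_left_mono order_trans[OF J_contraction[OF k2]] order_trans[OF J_contraction[OF k]]
        order_refl zero_le_power2)
  finally show ?thesis .
qed

text \<open>One double step is replaced at a time, and the remaining steps do not amplify the error.
  The induction varies \<open>x\<close>, \<open>z\<close>, \<open>w\<close> because the rest starts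
  from ?Q x, whose second image ?Q w is no larger than \<open>w\<close>.\<close>

lemma J_pow_halving:
  assumes k: "k > 0" and N: "(x, z) \<in> N" "(z, w) \<in> N"
  shows "norm ((J (2 * k) ^^ m) x - (J k ^^ (2 * m)) x) \<le> m * k\<^sup>2 * norm w"
  using N
proof (induction m arbitrary: x z w)
  case (Suc m)
  have k2: "2 * k > 0" using k by simp
  let ?Q = "\<lambda>x. J k (J k x)"
  have "(J (2 * k) ^^ Suc m) x - (J k ^^ (2 * Suc m)) x
      = (J (2 * k) ^^ m) (J (2 * k) x - ?Q x) + ((J (2 * k) ^^ m) (?Q x) - (J k ^^ (2 * m)) (?Q x))"
    by (simp add: J_pow_diff[OF k2] funpow_swap1)
  also have "norm \<dots> \<le> k\<^sup>2 * norm w + m * k\<^sup>2 * norm (?Q w)"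
    by (intro order_trans[OF norm_triangle_ineq] add_mono order_trans[OF J_pow_contraction[OF k2]]
        J_halving[OF k Suc.prems] Suc.IH[of "?Q x" "?Q z"] J_commute(1)[OF k] Suc.prems)
  also have "\<dots> \<le> k\<^sup>2 * norm w + m * k\<^sup>2 * norm w"
    by (intro add_left_mono mult_left_mono order_trans[OF J_contraction[OF k]] J_contraction[OF k]) simp
  finally show ?case by (simp add: algebra_simps)
qed simp

definition dom2 :: "'a set" where "dom2 = {x. \<exists>z w. (x, z) \<in> N \<and> (z, w) \<in> N}"

lemma Domain_approx:
  assumes "e > 0"
  obtains y where "y \<in> Domain N" and "norm (y - x) < e"
proof -
  have "x \<in> closure (Domain N)" by (simp add: dense_N)
  then show thesis using that assms unfolding closure_approachable dist_norm by blast
qed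

lemma J_tendsto_identity:
  assumes "e > 0"
  shows "\<exists>\<delta>>0. \<forall>h. 0 < h \<and> h \<le> \<delta> \<longrightarrow> norm (J h x - x) < e"
proof -
  obtain y where "y \<in> Domain N" and yx: "norm (y - x) < e / 3"
    using Domain_approx[of "e / 3" x] assms by auto
  then obtain z where y: "(y, z) \<in> N" by blast
  \<comment> \<open>Adding 1 keeps the quotient e / (3 d) meaningful when \<open>z\<close> is
    0.\<close>
  define d where "d = norm z + 1"
  have d: "d > 0" "norm z \<le> d" by (auto simp: d_def add_nonneg_pos)
  define \<delta> where "\<delta> = e / (3 * d)"
  have \<delta>: "\<delta> > 0" using assms d by (simp add: \<delta>_def)
  have "norm (J h x - x) < e" if h: "0 < h" "h \<le> \<delta>" for h
  proof -
    have "norm (J h y - y) \<le> h * norm z" by (rule J_near_identity[OF h(1) y])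
    also have "\<dots> \<le> \<delta> * d" using h d \<delta> by (intro mult_mono) auto
    also have "\<dots> = e / 3" using d by (simp add: \<delta>_def)
    finally have 1: "norm (J h y - y) \<le> e / 3" .
    have 2: "norm (J h (x - y)) \<le> norm (x - y)" by (rule J_contraction[OF h(1)])
    have "norm (J h x - x) \<le> norm (J h (x - y)) + norm (J h y - y) + norm (y - x)"
      using norm_triangle_ineq[of "J h (x - y) + (J h y - y)" "y - x"]
        norm_triangle_ineq[of "J h (x - y)" "J h y - y"] by (simp add: J_diff[OF h(1)])
    also have "\<dots> < e" using 1 2 yx norm_minus_commute[of x y] by linarith
    finally show ?thesis .
  qed
  with \<delta> show ?thesis by blast
qed

text \<open>The domain of the square of \<open>N\<close> is a core: a short step \<open>J h\<close>
  moves both entries of a graph point only slightly and gains one order of regularity.\<close>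

lemma graph_approx:
  assumes "(x, z) \<in> N" and "e > 0"
  obtains y z' w where "(y, z') \<in> N" "(z', w) \<in> N" "norm (y - x) < e" "norm (z' - z) < e"
proof -
  obtain \<delta> where \<delta>: "\<delta> > 0" "\<And>h. 0 < h \<Longrightarrow> h \<le> \<delta> \<Longrightarrow> norm (J h x - x) < e"
    using J_tendsto_identity[OF \<open>e > 0\<close>, of x] by blast
  obtain \<delta>' where \<delta>': "\<delta>' > 0" "\<And>h. 0 < h \<Longrightarrow> h \<le> \<delta>' \<Longrightarrow> norm (J h z - z) < e"
    using J_tendsto_identity[OF \<open>e > 0\<close>, of z] by blast
  define h where "h = min \<delta> \<delta>'"
  have h: "h > 0" using \<delta> \<delta>' by (simp add: h_def)
  show thesis
    using that[OF J_commute(1)[OF h assms(1)] J_graph[OF h]] \<delta> \<delta>' h by (simp add: h_def)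
qed

lemma dense_dom2: "closure dom2 = UNIV"
proof -
  have "x \<in> closure dom2" for x
    unfolding closure_approachable dist_norm
  proof (intro allI impI)
    fix e :: real assume "e > 0"
    then obtain y where "y \<in> Domain N" and yx: "norm (y - x) < e / 2"
      using Domain_approx[of "e / 2" x] by auto
    then obtain z where "(y, z) \<in> N" by blast
    then obtain u z' w where u: "(u, z') \<in> N" "(z', w) \<in> N" "norm (u - y) < e / 2"
      using graph_approx[of y z "e / 2"] \<open>e > 0\<close> by (metis half_gt_zero)
    have "norm (u - x) < e"
      using norm_triangle_ineq[of "u - y" "y - x"] u(3) yx by simp
    with u show "\<exists>u\<in>dom2. norm (u - x) < e" by (auto simp: dom2_def)
  qed
  then show ?thesis by blast
qed

section \<open>The dyadic Euler scheme and its limit\<close>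

abbreviation step :: "nat \<Rightarrow> real" where "step n \<equiv> (1 / 2) ^ n"

definition steps :: "nat \<Rightarrow> real \<Rightarrow> nat" where "steps n t = nat \<lfloor>t * 2 ^ n\<rfloor>"

lemma step_pos: "step n > 0" by simp

lemma steps_bounds:
  assumes "t \<ge> 0"
  shows "steps n t * step n \<le> t" and "t - step n \<le> steps n t * step n"
proof -
  have "real (steps n t) = of_int \<lfloor>t * 2 ^ n\<rfloor>" using assms by (simp add: steps_def)
  then have "real (steps n t) \<le> t * 2 ^ n" "t * 2 ^ n - 1 \<le> real (steps n t)"
    by linarith+
  then have "steps n t * step n \<le> (t * 2 ^ n) * step n"
    "(t * 2 ^ n - 1) * step n \<le> steps n t * step n"
    by (auto intro: mult_right_mono)
  then show "steps n t * step n \<le> t" "t - step n \<le> steps n t * step n"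
    by (simp_all add: left_diff_distrib diff_divide_distrib power_one_over)
qed

lemma steps_tendsto:
  assumes "t \<ge> 0"
  shows "(\<lambda>n. steps n t * step n) \<longlonglongrightarrow> t"
proof (rule tendsto_sandwich)
  have "(\<lambda>n. t - step n) \<longlonglongrightarrow> t - 0" by (intro tendsto_intros LIMSEQ_realpow_zero) auto
  then show "(\<lambda>n. t - step n) \<longlonglongrightarrow> t" by simp
qed (use steps_bounds[OF assms] in auto)

lemma steps_Suc:
  assumes "t \<ge> 0"
  shows "steps (Suc n) t = 2 * steps n t \<or> steps (Suc n) t = Suc (2 * steps n t)"
proof -
  define a where "a = t * 2 ^ n"
  have "a \<ge> 0" using assms by (simp add: a_def)
  have "\<lfloor>2 * a\<rfloor> = 2 * \<lfloor>a\<rfloor> \<or> \<lfloor>2 * a\<rfloor> = 2 * \<lfloor>a\<rfloor> + 1" by linarith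
  moreover have "\<lfloor>a\<rfloor> \<ge> 0" using \<open>a \<ge> 0\<close> by simp
  moreover have "steps (Suc n) t = nat \<lfloor>2 * a\<rfloor>" "steps n t = nat \<lfloor>a\<rfloor>"
    by (simp_all add: steps_def a_def mult.left_commute)
  ultimately show ?thesis by (auto simp: nat_add_distrib nat_mult_distrib)
qed

lemma steps_add:
  assumes "s \<ge> 0" "t \<ge> 0"
  shows "steps n (s + t) = steps n s + steps n t \<or> steps n (s + t) = Suc (steps n s + steps n t)"
proof -
  define a b where "a = s * 2 ^ n" and "b = t * 2 ^ n"
  have "a \<ge> 0" "b \<ge> 0" using assms by (simp_all add: a_def b_def)
  have "\<lfloor>a + b\<rfloor> = \<lfloor>a\<rfloor> + \<lfloor>b\<rfloor> \<or> \<lfloor>a + b\<rfloor> = \<lfloor>a\<rfloor> + \<lfloor>b\<rfloor> + 1" by linarith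
  moreover have "\<lfloor>a\<rfloor> \<ge> 0" "\<lfloor>b\<rfloor> \<ge> 0" using \<open>a \<ge> 0\<close> \<open>b \<ge> 0\<close> by simp_all
  moreover have "steps n (s + t) = nat \<lfloor>a + b\<rfloor>" "steps n s = nat \<lfloor>a\<rfloor>" "steps n t = nat \<lfloor>b\<rfloor>"
    by (simp_all add: steps_def a_def b_def algebra_simps)
  ultimately show ?thesis by (auto simp: nat_add_distrib)
qed

definition euler :: "nat \<Rightarrow> real \<Rightarrow> 'a \<Rightarrow> 'a"
  where "euler n t = J (step n) ^^ steps n t"

definition S :: "real \<Rightarrow> 'a \<Rightarrow> 'a"
  where "S t x = lim (\<lambda>n. euler n t x)"

lemma euler_contraction: "norm (euler n t x) \<le> norm x"
  unfolding euler_def by (rule J_pow_contraction[OF step_pos])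

lemma euler_diff: "euler n t (x - y) = euler n t x - euler n t y"
  unfolding euler_def by (rule J_pow_diff[OF step_pos])

text \<open>Two errors occur: halving every step costs the term with \<open>w\<close>, and the floor
  may admit one extra short step, which costs the term with \<open>z\<close>.\<close>

lemma euler_increment_le:
  assumes "t \<ge> 0" "(x, z) \<in> N" "(z, w) \<in> N"
  shows "norm (euler (Suc n) t x - euler n t x) \<le> step n * (t * norm w + norm z)"
proof -
  let ?k = "step (Suc n)" and ?m = "steps n t"
  have k: "?k > 0" and twice: "2 * ?k = step n" by simp_all
  let ?y = "(J ?k ^^ (2 * ?m)) x"
  have "norm (euler n t x - ?y) \<le> ?m * ?k\<^sup>2 * norm w"
    using J_pow_halving[OF k assms(2,3), of ?m] by (simp only: twice euler_def)
  also have "\<dots> = (?m * step n) * (step n / 4) * norm w" by (simp add: power2_eq_square)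
  also have "\<dots> \<le> t * step n * norm w"
    by (intro mult_right_mono mult_mono steps_bounds(1) assms(1)) simp_all
  finally have 1: "norm (euler n t x - ?y) \<le> t * step n * norm w" .
  have "norm (euler (Suc n) t x - ?y) \<le> step n * norm z"
    using steps_Suc[OF assms(1), of n]
  proof
    assume "steps (Suc n) t = Suc (2 * ?m)"
    then have "norm (euler (Suc n) t x - ?y) = norm (J ?k ?y - ?y)" by (simp add: euler_def)
    also have "\<dots> \<le> ?k * norm ((J ?k ^^ (2 * ?m)) z)"
      by (rule J_near_identity[OF k J_pow_graph[OF k assms(2)]])
    also have "\<dots> \<le> step n * norm z"
      by (intro mult_mono J_pow_contraction[OF k]) simp_all
    finally show ?thesis .
  qed (simp add: euler_def)
  with 1 show ?thesis
    using norm_triangle_ineq4[of "euler (Suc n) t x - ?y" "euler n t x - ?y"]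
    by (simp add: algebra_simps)
qed

lemma euler_tendsto:
  assumes "t \<ge> 0"
  shows "(\<lambda>n. euler n t x) \<longlonglongrightarrow> S t x"
proof -
  have "convergent (\<lambda>n. euler n t x)"
  proof (rule contractions_convergent_from_dense[OF dense_dom2])
    fix x assume "x \<in> dom2"
    then obtain z w where N: "(x, z) \<in> N" "(z, w) \<in> N" by (auto simp: dom2_def)
    have "summable (\<lambda>n. step n * (t * norm w + norm z))"
      by (intro summable_mult2 summable_geometric) simp
    then show "convergent (\<lambda>n. euler n t x)"
      by (rule convergent_if_summable_increments) (rule euler_increment_le[OF assms N])
  next
    show "norm (euler n t x - euler n t y) \<le> norm (x - y)" for n x y
      unfolding euler_diff[symmetric] by (rule euler_contraction)
  qed
  then show ?thesis unfolding S_def by (rule convergent_LIMSEQ_iff[THEN iffD1])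
qed

section \<open>Semigroup laws, continuity and generator\<close>

lemma S_add: "t \<ge> 0 \<Longrightarrow> S t (x + y) = S t x + S t y"
proof (rule LIMSEQ_unique[OF euler_tendsto])
  assume "t \<ge> 0"
  then show "(\<lambda>n. euler n t (x + y)) \<longlonglongrightarrow> S t x + S t y"
    unfolding euler_def J_pow_add[OF step_pos] by (intro tendsto_add euler_tendsto[unfolded euler_def])
qed

lemma S_scaleC: "t \<ge> 0 \<Longrightarrow> S t (c *\<^sub>C x) = c *\<^sub>C S t x"
proof (rule LIMSEQ_unique[OF euler_tendsto])
  assume "t \<ge> 0"
  then show "(\<lambda>n. euler n t (c *\<^sub>C x)) \<longlonglongrightarrow> c *\<^sub>C S t x"
    unfolding euler_def J_pow_scaleC[OF step_pos]
    by (intro bounded_linear.tendsto[OF bounded_linear_scaleC] euler_tendsto[unfolded euler_def])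
qed

lemma S_diff: "t \<ge> 0 \<Longrightarrow> S t (x - y) = S t x - S t y"
  using S_add[of t "x - y" y] by simp

lemma S_contraction: "t \<ge> 0 \<Longrightarrow> norm (S t x) \<le> norm x"
  by (rule LIMSEQ_le_const2[OF tendsto_norm[OF euler_tendsto]]) (auto intro: euler_contraction)

lemma S_0: "S 0 x = x"
  by (simp add: S_def euler_def steps_def)

lemma S_semigroup:
  assumes "s \<ge> 0" "t \<ge> 0"
  shows "S (s + t) x = S s (S t x)"
proof (rule LIMSEQ_unique[OF euler_tendsto])
  show "s + t \<ge> 0" using assms by simp
  \<comment> \<open>The two floors may lose one step against the floor of the sum. That extra step
    \<open>?E n\<close> tends strongly to the identity, so it disappears in the limit.\<close>
  have "\<exists>e\<in>{0, 1}. steps n (s + t) = e + (steps n s + steps n t)" for n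
    using steps_add[OF assms, of n] by auto
  then have "\<exists>e. \<forall>n. e n \<in> {0, 1} \<and> steps n (s + t) = e n + (steps n s + steps n t)"
    by (intro choice) blast
  then obtain e where e: "\<And>n. e n \<in> {0, 1 :: nat}"
    "\<And>n. steps n (s + t) = e n + (steps n s + steps n t)" by blast
  let ?E = "\<lambda>n. J (step n) ^^ e n"
  have euler_eq: "euler n (s + t) x = ?E n (euler n s (euler n t x))" for n
    by (simp add: euler_def e(2) funpow_add)
  have E_contr: "norm (?E n y) \<le> norm y" for n y by (rule J_pow_contraction[OF step_pos])
  have lim: "(\<lambda>n. euler n s (euler n t x)) \<longlonglongrightarrow> S s (S t x)"
  proof -
    have "(\<lambda>n. euler n s (euler n t x - S t x)) \<longlonglongrightarrow> 0"
    proof (rule Lim_null_comparison)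
      show "(\<lambda>n. norm (euler n t x - S t x)) \<longlonglongrightarrow> 0"
        using euler_tendsto[OF assms(2), of x] by (simp add: LIM_zero_iff tendsto_norm_zero_iff)
    qed (simp add: euler_contraction)
    from tendsto_add[OF this euler_tendsto[OF assms(1), of "S t x"]] show ?thesis
      by (simp add: euler_diff)
  qed
  have "(\<lambda>n. ?E n y) \<longlonglongrightarrow> y" for y
  proof (rule LIMSEQ_I)
    fix r :: real assume "r > 0"
    then obtain \<delta> where \<delta>: "\<delta> > 0" "\<And>h. 0 < h \<Longrightarrow> h \<le> \<delta> \<Longrightarrow> norm (J h y - y) < r"
      using J_tendsto_identity[OF \<open>r > 0\<close>, of y] by blast
    obtain M where M: "step M < \<delta>" using real_arch_pow_inv[of \<delta> "1 / 2"] \<delta>(1) by auto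
    have "norm (?E n y - y) < r" if "n \<ge> M" for n
    proof -
      have "step n \<le> step M" using that by (rule power_decreasing) auto
      then have "norm (J (step n) y - y) < r"
        using M \<delta>(2)[OF step_pos, of n] by linarith
      then show ?thesis using e(1)[of n] \<open>r > 0\<close> by auto
    qed
    then show "\<exists>M. \<forall>n\<ge>M. norm (?E n y - y) < r" by blast
  qed
  note E_lim = this
  have "(\<lambda>n. ?E n (euler n s (euler n t x) - S s (S t x))) \<longlonglongrightarrow> 0"
  proof (rule Lim_null_comparison)
    show "(\<lambda>n. norm (euler n s (euler n t x) - S s (S t x))) \<longlonglongrightarrow> 0"
      using lim by (simp add: LIM_zero_iff tendsto_norm_zero_iff)
  qed (simp add: E_contr)
  from tendsto_add[OF this E_lim[of "S s (S t x)"]]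
  show "(\<lambda>n. euler n (s + t) x) \<longlonglongrightarrow> S s (S t x)"
    by (simp add: euler_eq J_pow_diff[OF step_pos])
qed

lemma S_near_identity:
  assumes "t \<ge> 0" "(x, z) \<in> N"
  shows "norm (S t x - x) \<le> t * norm z"
proof (rule LIMSEQ_le_const2)
  show "(\<lambda>n. norm (euler n t x - x)) \<longlonglongrightarrow> norm (S t x - x)"
    by (intro tendsto_intros euler_tendsto assms)
  have "norm (euler n t x - x) \<le> steps n t * step n * norm z" for n
    unfolding euler_def by (rule J_pow_near_identity[OF step_pos assms(2)])
  also have "\<dots> n \<le> t * norm z" for n
    by (intro mult_right_mono steps_bounds assms norm_ge_zero)
  finally show "\<exists>M. \<forall>n\<ge>M. norm (euler n t x - x) \<le> t * norm z" by blast
qed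

lemma S_second_order:
  assumes "t \<ge> 0" "(x, z) \<in> N" "(z, w) \<in> N"
  shows "norm (S t x - x - t *\<^sub>R z) \<le> t\<^sup>2 * norm w"
proof (rule LIMSEQ_le_const2)
  show "(\<lambda>n. norm (euler n t x - x - (steps n t * step n) *\<^sub>R z)) \<longlonglongrightarrow> norm (S t x - x - t *\<^sub>R z)"
    by (intro tendsto_intros euler_tendsto steps_tendsto assms)
  have "norm (euler n t x - x - (steps n t * step n) *\<^sub>R z) \<le> t\<^sup>2 * norm w" for n
    unfolding euler_def
    by (rule order_trans[OF J_pow_second_order[OF step_pos assms(2,3)]])
      (intro mult_right_mono power_mono steps_bounds assms norm_ge_zero, simp)
  then show "\<exists>M. \<forall>n\<ge>M. norm (euler n t x - x - (steps n t * step n) *\<^sub>R z) \<le> t\<^sup>2 * norm w"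
    by blast
qed

lemma S_continuous: "continuous_on {0..} (\<lambda>t. S t x)"
proof -
  have close: "\<exists>\<delta>>0. \<forall>t. 0 \<le> t \<and> t < \<delta> \<longrightarrow> norm (S t x - x) < e" if "e > 0" for e
  proof -
    obtain y z where y: "(y, z) \<in> N" "norm (y - x) < e / 3"
      using Domain_approx[of "e / 3" x] \<open>e > 0\<close> by (metis DomainE divide_pos_pos zero_less_numeral)
    define d where "d = norm z + 1"
    have d: "d > 0" "norm z \<le> d" by (auto simp: d_def add_nonneg_pos)
    define \<delta> where "\<delta> = e / (3 * d)"
    have "\<delta> > 0" using \<open>e > 0\<close> d by (simp add: \<delta>_def)
    moreover have "norm (S t x - x) < e" if t: "0 \<le> t" "t < \<delta>" for t
    proof -
      have "norm (S t y - y) \<le> t * norm z" by (rule S_near_identity[OF t(1) y(1)])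
      also have "\<dots> \<le> \<delta> * d" using t d \<open>\<delta> > 0\<close> by (intro mult_mono) auto
      also have "\<dots> = e / 3" using d by (simp add: \<delta>_def)
      finally have "norm (S t y - y) \<le> e / 3" .
      moreover have "norm (S t x - S t y) \<le> norm (x - y)"
        unfolding S_diff[OF t(1), symmetric] by (rule S_contraction[OF t(1)])
      moreover have "norm (S t x - x) \<le> norm (S t x - S t y) + norm (S t y - y) + norm (y - x)"
        using norm_triangle_ineq[of "S t x - S t y + (S t y - y)" "y - x"]
          norm_triangle_ineq[of "S t x - S t y" "S t y - y"] by simp
      ultimately show ?thesis using y(2) norm_minus_commute[of x y] by linarith
    qed
    ultimately show ?thesis by blast
  qed
  \<comment> \<open>Factoring out the shorter time by contractivity reduces continuity everywhere to
    continuity at 0.\<close>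
  have incr: "norm (S t x - S s x) \<le> norm (S (t - s) x - x)" if "0 \<le> s" "s \<le> t" for s t
  proof -
    have "S t x = S s (S (t - s) x)" using S_semigroup[of s "t - s" x] that by simp
    then show ?thesis
      using S_contraction[OF that(1), of "S (t - s) x - x"] by (simp add: S_diff[OF that(1)])
  qed
  show ?thesis
    unfolding continuous_on_iff
  proof (intro ballI allI impI)
    fix s e :: real assume "s \<in> {0..}" "e > 0"
    obtain \<delta> where \<delta>: "\<delta> > 0" "\<And>t. 0 \<le> t \<Longrightarrow> t < \<delta> \<Longrightarrow> norm (S t x - x) < e"
      using close[OF \<open>e > 0\<close>] by blast
    have "dist (S t x) (S s x) < e" if "t \<in> {0..}" "dist t s < \<delta>" for t
    proof (cases "s \<le> t")
      case True
      then show ?thesis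
        using incr[of s t] \<delta>(2)[of "t - s"] that \<open>s \<in> {0..}\<close> by (auto simp: dist_norm)
    next
      case False
      then show ?thesis
        using incr[of t s] \<delta>(2)[of "s - t"] that \<open>s \<in> {0..}\<close>
        by (auto simp: dist_norm norm_minus_commute)
    qed
    then show "\<exists>d>0. \<forall>t\<in>{0..}. dist t s < d \<longrightarrow> dist (S t x) (S s x) < e"
      using \<open>\<delta> > 0\<close> by blast
  qed
qed

text \<open>The second-order estimate applies only on the domain of the square of \<open>N\<close>.
  Approximating in the graph norm suffices, because the difference quotient of x - y is bounded by
  the norm of z - z' uniformly in t.\<close>

lemma S_derivative_at_0:
  assumes "(x, z) \<in> N"
  shows "((\<lambda>t. (1 / t) *\<^sub>R (S t x - x)) \<longlongrightarrow> z) (at_right 0)"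
proof (rule tendstoI)
  fix e :: real assume "e > 0"
  then obtain y z' w where y: "(y, z') \<in> N" "(z', w) \<in> N" "norm (z' - z) < e / 3"
    using graph_approx[OF assms, of "e / 3"] by (metis divide_pos_pos zero_less_numeral)
  define d where "d = norm w + 1"
  have d: "d > 0" "norm w \<le> d" by (auto simp: d_def add_nonneg_pos)
  define \<delta> where "\<delta> = e / (3 * d)"
  have "\<delta> > 0" using \<open>e > 0\<close> d by (simp add: \<delta>_def)
  have "dist ((1 / t) *\<^sub>R (S t x - x)) z < e" if t: "0 < t" "t < \<delta>" for t
  proof -
    let ?D = "\<lambda>u. (1 / t) *\<^sub>R (S t u - u)"
    have t0: "t \<ge> 0" using t by simp
    have D_diff: "?D x - ?D y = ?D (x - y)" by (simp add: S_diff[OF t0] algebra_simps)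
    have "norm (S t (x - y) - (x - y)) \<le> t * norm (z - z')"
      by (rule S_near_identity[OF t0 graph_diff[OF subspace_N assms y(1)]])
    then have 1: "norm (?D (x - y)) \<le> norm (z - z')"
      using t by (simp add: pos_divide_le_eq mult.commute)
    have "?D y - z' = (1 / t) *\<^sub>R (S t y - y - t *\<^sub>R z')" using t by (simp add: scaleR_diff_right)
    then have "norm (?D y - z') = norm (S t y - y - t *\<^sub>R z') / t" using t by simp
    also have "\<dots> \<le> t\<^sup>2 * norm w / t"
      using t S_second_order[OF t0 y(1,2)] by (intro divide_right_mono) simp_all
    also have "\<dots> = t * norm w" using t by (simp add: power2_eq_square)
    also have "\<dots> \<le> \<delta> * d" using t d \<open>\<delta> > 0\<close> by (intro mult_mono) auto
    also have "\<dots> = e / 3" using d by (simp add: \<delta>_def)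
    finally have 2: "norm (?D y - z') \<le> e / 3" .
    have "norm (?D x - z) \<le> norm (?D x - ?D y) + norm (?D y - z') + norm (z' - z)"
      using norm_triangle_ineq[of "?D x - ?D y + (?D y - z')" "z' - z"]
        norm_triangle_ineq[of "?D x - ?D y" "?D y - z'"] by simp
    also have "\<dots> < e" using 1 2 y(3) norm_minus_commute[of z z'] D_diff by simp
    finally show ?thesis by (simp add: dist_norm)
  qed
  then show "\<forall>\<^sub>F t in at_right 0. dist ((1 / t) *\<^sub>R (S t x - x)) z < e"
    unfolding eventually_at_right_field using \<open>\<delta> > 0\<close> by blast
qed

text \<open>Maximality of \<open>N\<close>: choose \<open>u\<close> with (1 - N) u = x - z. Then the
  difference quotients at x - u tend to x - u itself, while contractivity makes their scalar
  products with x - u have nonpositive real part, so x = u.\<close>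

lemma derivative_at_0_in_graph:
  assumes lim: "((\<lambda>t. (1 / t) *\<^sub>R (S t x - x)) \<longlongrightarrow> z) (at_right 0)"
  shows "(x, z) \<in> N"
proof -
  obtain u where u: "(u, u - (x - z)) \<in> N"
    using range_condition_all[of 1 "x - z"] by auto
  let ?D = "\<lambda>t v. (1 / t) *\<^sub>R (S t v - v)"
  have "((\<lambda>t. ?D t x - ?D t u) \<longlongrightarrow> z - (u - (x - z))) (at_right 0)"
    by (intro tendsto_diff lim S_derivative_at_0[OF u])
  moreover have "\<forall>\<^sub>F t in at_right 0. ?D t x - ?D t u = ?D t (x - u)"
    unfolding eventually_at_right_field
    by (intro exI[of _ 1]) (auto simp: S_diff algebra_simps)
  ultimately have "((\<lambda>t. ?D t (x - u)) \<longlongrightarrow> x - u) (at_right 0)"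
    by (simp add: tendsto_cong)
  then have "((\<lambda>t. Re (cinner (x - u) (?D t (x - u)))) \<longlongrightarrow> Re (cinner (x - u) (x - u))) (at_right 0)"
    by (intro tendsto_Re cinner.tendsto tendsto_const)
  moreover have "\<forall>\<^sub>F t in at_right 0. Re (cinner (x - u) (?D t (x - u))) \<le> 0"
    unfolding eventually_at_right_field
  proof (intro exI[of _ 1] conjI allI impI)
    fix t :: real assume "0 < t" "t < 1"
    have "Re (cinner (x - u) (S t (x - u))) \<le> norm (x - u) * norm (x - u)"
      using \<open>0 < t\<close> by (intro order_trans[OF Re_cinner_le] mult_left_mono S_contraction) auto
    then have "Re (cinner (x - u) (S t (x - u) - (x - u))) \<le> 0"
      by (simp add: cinner.diff_right[of "x - u" _ "x - u"] Re_cinner_self power2_eq_square)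
    then show "Re (cinner (x - u) (?D t (x - u))) \<le> 0"
      using \<open>0 < t\<close> by (simp only: cinner_scaleR_right) (simp add: divide_le_0_iff)
  qed simp
  ultimately have "Re (cinner (x - u) (x - u)) \<le> 0"
    by (intro tendsto_upperbound) auto
  then have "x = u" by (simp add: Re_cinner_self)
  with u show ?thesis by simp
qed

theorem generates_contraction_semigroup: "generates_contraction_semigroup univ_space N"
  unfolding generates_contraction_semigroup_def
proof (intro exI conjI)
  show "contraction_semigroup univ_space S"
    by (simp add: contraction_semigroup_def hnorm_univ_space htop_univ_space S_continuous
        S_contraction S_0 S_add S_scaleC S_semigroup) (simp add: univ_space_def)
  show "generator univ_space S = N"
    using S_derivative_at_0 derivative_at_0_in_graph
    by (auto simp: generator_def htop_univ_space) (auto simp: univ_space_def)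
qed

end

section \<open>Transport along unitary maps\<close>

text \<open>\<^const>\<open>hnorm\<close> has to be nonnegative and even on the whole type, not only on the carrier,
  for the locale \<^locale>\<open>Metric_space\<close> to apply.\<close>

locale unitary_map =
  fixes H :: "'a::complex_vector inner_space"
    and \<phi> :: "'a \<Rightarrow> 'b::complex_inner" and \<psi> :: "'b \<Rightarrow> 'a"
  assumes subspace: "csubspace (hcarrier H)"
    and \<phi>_\<psi> [simp]: "\<phi> (\<psi> y) = y" and \<psi>_in [simp]: "\<psi> y \<in> hcarrier H"
    and \<psi>_\<phi> [simp]: "x \<in> hcarrier H \<Longrightarrow> \<psi> (\<phi> x) = x"
    and \<phi>_add: "x \<in> hcarrier H \<Longrightarrow> x' \<in> hcarrier H \<Longrightarrow> \<phi> (x + x') = \<phi> x + \<phi> x'"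
    and \<phi>_scaleC: "x \<in> hcarrier H \<Longrightarrow> \<phi> (c *\<^sub>C x) = c *\<^sub>C \<phi> x"
    and \<phi>_inner: "x \<in> hcarrier H \<Longrightarrow> x' \<in> hcarrier H \<Longrightarrow> hinner H x x' = cinner (\<phi> x) (\<phi> x')"
    and hnorm_nonneg: "hnorm H x \<ge> 0"
    and hnorm_minus: "hnorm H (- x) = hnorm H x"
begin

lemma \<phi>_scaleR: "x \<in> hcarrier H \<Longrightarrow> \<phi> (r *\<^sub>R x) = r *\<^sub>R \<phi> x"
  by (simp add: scaleR_scaleC \<phi>_scaleC)

lemma \<phi>_diff:
  assumes "x \<in> hcarrier H" "x' \<in> hcarrier H"
  shows "\<phi> (x - x') = \<phi> x - \<phi> x'"
  using \<phi>_add[of "x - x'" x'] assms csubspace_diff[OF subspace] by simp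

lemma \<phi>_inject: "x \<in> hcarrier H \<Longrightarrow> x' \<in> hcarrier H \<Longrightarrow> \<phi> x = \<phi> x' \<longleftrightarrow> x = x'"
  by (metis \<psi>_\<phi>)

lemma \<psi>_add: "\<psi> (y + y') = \<psi> y + \<psi> y'"
  using \<psi>_\<phi>[of "\<psi> y + \<psi> y'"] by (simp add: \<phi>_add csubspace_add[OF subspace])

lemma \<psi>_scaleC: "\<psi> (c *\<^sub>C y) = c *\<^sub>C \<psi> y"
  using \<psi>_\<phi>[of "c *\<^sub>C \<psi> y"] by (simp add: \<phi>_scaleC csubspace_scaleC[OF subspace])

lemma hnorm_eq: "x \<in> hcarrier H \<Longrightarrow> hnorm H x = norm (\<phi> x)"
  by (simp add: hnorm_def \<phi>_inner Re_cinner_self)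

lemma hnorm_diff_eq:
  "x \<in> hcarrier H \<Longrightarrow> x' \<in> hcarrier H \<Longrightarrow> hnorm H (x - x') = dist (\<phi> x) (\<phi> x')"
  by (simp add: hnorm_eq csubspace_diff[OF subspace] \<phi>_diff dist_norm)

lemma Metric_space_H: "Metric_space (hcarrier H) (\<lambda>x y. hnorm H (x - y))"
proof
  show "hnorm H (x - y) = hnorm H (y - x)" for x y
    using hnorm_minus[of "x - y"] by simp
qed (simp_all add: hnorm_nonneg hnorm_diff_eq \<phi>_inject dist_triangle)

lemma topspace_htop: "topspace (htop H) = hcarrier H"
  unfolding htop_def by (rule Metric_space.topspace_mtopology[OF Metric_space_H])

lemma homeomorphic_\<phi>: "homeomorphic_map (htop H) euclidean \<phi>"
proof -
  interpret Metric_space12 "hcarrier H" "\<lambda>x y. hnorm H (x - y)" UNIV "dist :: 'b \<Rightarrow> 'b \<Rightarrow> real"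
    by (intro Metric_space12.intro Metric_space_H) (rule Met_TC.Metric_space_axioms)
  have "\<phi> ` hcarrier H = UNIV" by (metis \<phi>_\<psi> \<psi>_in surj_def UNIV_eq_I imageI)
  then have "homeomorphic_map M1.mtopology Met_TC.mtopology \<phi>"
    by (rule isometry_imp_homeomorphic_map) (simp add: hnorm_diff_eq)
  then show ?thesis by (simp add: htop_def)
qed

lemma continuous_\<phi>: "continuous_map (htop H) euclidean \<phi>"
  by (rule homeomorphic_imp_continuous_map[OF homeomorphic_\<phi>])

lemma continuous_\<psi>: "continuous_map euclidean (htop H) \<psi>"
proof -
  obtain g where g: "homeomorphic_maps (htop H) euclidean \<phi> g"
    using homeomorphic_\<phi> homeomorphic_map_maps by blast
  have "g (\<phi> (\<psi> y)) = \<psi> y" for y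
    using g \<psi>_in[of y] by (simp add: homeomorphic_maps_def topspace_htop del: \<phi>_\<psi>)
  then have "g y = \<psi> y" for y by simp
  moreover have "continuous_map euclidean (htop H) g" using g by (simp add: homeomorphic_maps_def)
  ultimately show ?thesis using continuous_map_eq by blast
qed

text \<open>The operator \<open>N\<close> conjugated by the unitary map, on its natural
  domain.\<close>

definition pull :: "('b, 'b) graph \<Rightarrow> ('a, 'a) graph"
  where "pull N = {(x, y). x \<in> hcarrier H \<and> y \<in> hcarrier H \<and> (\<phi> x, \<phi> y) \<in> N}"

lemma densely_defined_pull:
  assumes "closure (Domain N) = UNIV"
  shows "densely_defined H (pull N)"
proof -
  have "Domain N \<subseteq> \<phi> ` Domain (pull N)"
  proof
    fix x assume "x \<in> Domain N"
    then obtain y where "(x, y) \<in> N" by blast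
    then have "(\<psi> x, \<psi> y) \<in> pull N" by (simp add: pull_def)
    then show "x \<in> \<phi> ` Domain (pull N)" by (metis DomainI \<phi>_\<psi> imageI)
  qed
  moreover have sub: "Domain (pull N) \<subseteq> hcarrier H" by (auto simp: pull_def)
  ultimately have "\<phi> ` (htop H closure_of Domain (pull N)) = UNIV"
    using homeomorphic_map_closure_of[OF homeomorphic_\<phi>, of "Domain (pull N)"]
      closure_mono[of "Domain N" "\<phi> ` Domain (pull N)"] assms
    by (auto simp: topspace_htop)
  moreover have cl: "htop H closure_of Domain (pull N) \<subseteq> hcarrier H"
    by (metis closure_of_subset_topspace topspace_htop)
  ultimately have "x \<in> htop H closure_of Domain (pull N)" if "x \<in> hcarrier H" for x
    using that \<phi>_inject by (metis (no_types, lifting) UNIV_I imageE subsetD)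
  with cl show ?thesis unfolding densely_defined_def by blast
qed

lemma linear_op_pull:
  assumes "csubspace N" "single_valued N"
  shows "linear_op H H (pull N)"
  unfolding linear_op_def
proof (intro conjI)
  have "\<phi> 0 = 0" using \<phi>_diff[of "\<psi> 0" "\<psi> 0"] by simp
  then show "csubspace (pull N)"
    unfolding csubspace_iff
    by (auto simp: pull_def scaleC_Pair zero_prod_def \<phi>_add \<phi>_scaleC csubspace_0[OF subspace]
        csubspace_add[OF subspace] csubspace_scaleC[OF subspace]
        intro: graph_zero[OF assms(1)] graph_add[OF assms(1)] graph_scaleC[OF assms(1)])
  show "single_valued (pull N)"
    using assms(2) by (auto simp: pull_def single_valued_def \<phi>_inject[symmetric])
qed (auto simp: pull_def)

lemma closed_op_pull:
  assumes "csubspace N" "single_valued N" "closed N"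
  shows "closed_op H H (pull N)"
proof -
  let ?T = "prod_topology (htop H) (htop H)"
  have "continuous_map ?T (prod_topology euclidean euclidean) (\<lambda>p. (\<phi> (fst p), \<phi> (snd p)))"
    using continuous_map_compose[OF continuous_map_fst continuous_\<phi>]
      continuous_map_compose[OF continuous_map_snd continuous_\<phi>]
    by (intro continuous_map_pairedI) (simp_all add: o_def)
  then have "closedin ?T {p \<in> topspace ?T. (\<phi> (fst p), \<phi> (snd p)) \<in> N}"
    using assms(3) unfolding prod_topology_euclidean closed_closedin
    by (rule closedin_continuous_map_preimage)
  moreover have "{p \<in> topspace ?T. (\<phi> (fst p), \<phi> (snd p)) \<in> N} = pull N"
    by (auto simp: pull_def topspace_htop)
  ultimately show ?thesis
    using linear_op_pull[OF assms(1,2)] by (simp add: closed_op_def)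
qed

lemma accretive_minus_pull:
  assumes "\<And>x y. (x, y) \<in> N \<Longrightarrow> Re (cinner x y) \<le> 0"
  shows "accretive H (op_scale (-1) (pull N))"
  using assms
  by (auto simp: accretive_def op_scale_def pull_def \<phi>_inner \<phi>_scaleC[of _ "-1", simplified]
      csubspace_scaleC[OF subspace, of _ "-1", simplified] cinner.minus_right)

lemma contraction_semigroup_univ:
  assumes "contraction_semigroup (univ_space :: 'b inner_space) S"
  shows "t \<ge> 0 \<Longrightarrow> S t (x + y) = S t x + S t y" "t \<ge> 0 \<Longrightarrow> S t (c *\<^sub>C x) = c *\<^sub>C S t x"
    "S 0 x = x" "s \<ge> 0 \<Longrightarrow> t \<ge> 0 \<Longrightarrow> S (s + t) x = S s (S t x)"
    "t \<ge> 0 \<Longrightarrow> norm (S t x) \<le> norm x" "continuous_on {0..} (\<lambda>t. S t x)"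
  using assms unfolding contraction_semigroup_def hnorm_univ_space htop_univ_space
  by (simp_all add: univ_space_def)

lemma contraction_semigroup_pull:
  assumes S: "contraction_semigroup (univ_space :: 'b inner_space) S"
  shows "contraction_semigroup H (\<lambda>t x. \<psi> (S t (\<phi> x)))"
  unfolding contraction_semigroup_def
proof (intro conjI ballI allI impI)
  note S = contraction_semigroup_univ[OF S]
  fix x assume x: "x \<in> hcarrier H"
  show "\<psi> (S 0 (\<phi> x)) = x" using x by (simp add: S(3))
  show "continuous_map (top_of_set {0..}) (htop H) (\<lambda>t. \<psi> (S t (\<phi> x)))"
    using continuous_map_compose[OF _ continuous_\<psi>, of "top_of_set {0..}" "\<lambda>t. S t (\<phi> x)"] S(6)
    by (simp add: o_def)
  fix t :: real assume t: "t \<ge> 0"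
  show "\<psi> (S t (\<phi> (x + y))) = \<psi> (S t (\<phi> x)) + \<psi> (S t (\<phi> y))" if "y \<in> hcarrier H" for y
    using x t that by (simp add: \<phi>_add S(1) \<psi>_add)
  show "\<psi> (S t (\<phi> (c *\<^sub>C x))) = c *\<^sub>C \<psi> (S t (\<phi> x))" for c
    using x t by (simp add: \<phi>_scaleC S(2) \<psi>_scaleC)
  show "hnorm H (\<psi> (S t (\<phi> x))) \<le> hnorm H x"
    using x t by (simp add: hnorm_eq S(5))
  show "\<psi> (S (s + t) (\<phi> x)) = \<psi> (S s (\<phi> (\<psi> (S t (\<phi> x)))))" if "s \<ge> 0" for s
    using t that by (simp add: S(4))
qed auto

lemma generator_pull:
  "generator H (\<lambda>t x. \<psi> (S t (\<phi> x))) = pull (generator univ_space S)"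
proof -
  let ?f = "\<lambda>x t. (1 / t) *\<^sub>R (\<psi> (S t (\<phi> x)) - x)"
  let ?g = "\<lambda>x t. (1 / t) *\<^sub>R (S t (\<phi> x) - \<phi> x)"
  have f_in: "?f x t \<in> hcarrier H" if "x \<in> hcarrier H" for x t
    using that by (intro csubspace_scaleR[OF subspace] csubspace_diff[OF subspace]) simp_all
  have \<phi>_f: "\<phi> (?f x t) = ?g x t" if "x \<in> hcarrier H" for x t
    using that by (simp add: \<phi>_scaleR \<phi>_diff csubspace_diff[OF subspace])
  have "limitin (htop H) (?f x) y (at_right 0)
      \<longleftrightarrow> y \<in> hcarrier H \<and> (?g x \<longlongrightarrow> \<phi> y) (at_right 0)" if x: "x \<in> hcarrier H" for x y
  proof
    assume lim: "limitin (htop H) (?f x) y (at_right 0)"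
    show "y \<in> hcarrier H \<and> (?g x \<longlongrightarrow> \<phi> y) (at_right 0)"
      using limitin_topspace[OF lim] continuous_map_limit[OF continuous_\<phi> lim]
      by (simp add: topspace_htop o_def \<phi>_f[OF x])
  next
    assume y: "y \<in> hcarrier H \<and> (?g x \<longlongrightarrow> \<phi> y) (at_right 0)"
    have "?f x = \<psi> \<circ> ?g x"
      using \<psi>_\<phi>[OF f_in[OF x]] by (simp add: fun_eq_iff \<phi>_f[OF x])
    then show "limitin (htop H) (?f x) y (at_right 0)"
      using y continuous_map_limit[OF continuous_\<psi>, of "?g x" "\<phi> y" "at_right 0"] by simp
  qed
  then show ?thesis
    by (auto simp: generator_def pull_def htop_univ_space) (simp_all add: univ_space_def)
qed

lemma generates_contraction_semigroup_pull:
  assumes "generates_contraction_semigroup univ_space N"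
  shows "generates_contraction_semigroup H (pull N)"
  using assms contraction_semigroup_pull generator_pull
  unfolding generates_contraction_semigroup_def by metis

end

section \<open>The operator matrices\<close>

text \<open>Everything is parametrised by \<open>C = |A|\<inverse>\<close>, \<open>r = R C\<close> and the values \<open>x = |A| f\<close>,
  \<open>y = |A| g\<close>, which turns the four operators into ranges of everywhere defined maps.  \<open>N_op C r\<close>
  is \<open>- \<i> Q\<close>, the unitary conjugate of \<open>G\<close>.\<close>

definition N_op :: "('a::complex_vector \<Rightarrow> 'a) \<Rightarrow> ('a \<Rightarrow> 'a) \<Rightarrow> ('a \<times> 'a, 'a \<times> 'a) graph"
  where "N_op C r = range (\<lambda>(x, y). ((C x, C y), (- r x - \<i> *\<^sub>C y, - (\<i> *\<^sub>C x))))"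

lemma scaleC_i_i [simp]: "\<i> *\<^sub>C \<i> *\<^sub>C x = - (x :: 'a::complex_vector)"
  by (simp add: scaleC_scaleC)

lemma N_op_iff: "((f, g), (p, q)) \<in> N_op C r \<longleftrightarrow>
    (\<exists>x y. f = C x \<and> g = C y \<and> p = - r x - \<i> *\<^sub>C y \<and> q = - (\<i> *\<^sub>C x))"
  by (auto simp: N_op_def)

context
  fixes C r :: "'a::chilbert_space \<Rightarrow>\<^sub>L 'a"
  assumes injC: "inj C" and linC: "\<And>c x. C (c *\<^sub>C x) = c *\<^sub>C C x"
    and linr: "\<And>c x. r (c *\<^sub>C x) = c *\<^sub>C r x"
begin

section \<open>The model operator on the product type\<close>

lemma csubspace_N_op: "csubspace (N_op C r)"
  unfolding csubspace_iff
proof (intro conjI ballI allI)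
  show "0 \<in> N_op C r"
    unfolding N_op_def by (rule range_eqI[of _ _ 0]) (simp add: zero_prod_def)
  fix p assume "p \<in> N_op C r"
  then obtain x y where p: "p = ((C x, C y), (- r x - \<i> *\<^sub>C y, - (\<i> *\<^sub>C x)))"
    by (auto simp: N_op_def)
  show "c *\<^sub>C p \<in> N_op C r" for c
    unfolding N_op_def p
    by (rule range_eqI[of _ _ "(c *\<^sub>C x, c *\<^sub>C y)"])
      (simp add: scaleC_Pair linC linr scaleC_diff_right scaleC_scaleC mult.commute)
  fix q assume "q \<in> N_op C r"
  then obtain u v where q: "q = ((C u, C v), (- r u - \<i> *\<^sub>C v, - (\<i> *\<^sub>C u)))"
    by (auto simp: N_op_def)
  show "p + q \<in> N_op C r"
    unfolding N_op_def p q
    by (rule range_eqI[of _ _ "(x + u, y + v)"]) (simp add: blinfun.add_right scaleC_add_right)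
qed

lemma single_valued_N_op: "single_valued (N_op C r)"
  by (rule single_valuedI) (auto simp: N_op_def dest: injD[OF injC])

text \<open>The values determine the parameters continuously: \<open>x\<close> from the last
  component, and then \<open>y\<close> from the third because \<open>r\<close> is bounded.\<close>

lemma closed_N_op: "closed (N_op C r)"
  unfolding closed_sequential_limits
proof (intro allI impI, elim conjE)
  fix s l assume "\<forall>n. s n \<in> N_op C r" and lim: "s \<longlonglongrightarrow> l"
  then have "\<forall>n. \<exists>z. s n = ((C (fst z), C (snd z)),
      (- r (fst z) - \<i> *\<^sub>C snd z, - (\<i> *\<^sub>C fst z)))"
    by (fastforce simp: N_op_def)
  then obtain z where z: "\<And>n. s n = ((C (fst (z n)), C (snd (z n))),
      (- r (fst (z n)) - \<i> *\<^sub>C snd (z n), - (\<i> *\<^sub>C fst (z n))))"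
    using choice by metis
  obtain a b c d where l: "l = ((a, b), (c, d))" by (metis surj_pair)
  have a: "(\<lambda>n. C (fst (z n))) \<longlonglongrightarrow> a" and b: "(\<lambda>n. C (snd (z n))) \<longlonglongrightarrow> b"
    and c: "(\<lambda>n. - r (fst (z n)) - \<i> *\<^sub>C snd (z n)) \<longlonglongrightarrow> c"
    and d: "(\<lambda>n. - (\<i> *\<^sub>C fst (z n))) \<longlonglongrightarrow> d"
    using tendsto_fst[OF tendsto_fst[OF lim]] tendsto_snd[OF tendsto_fst[OF lim]]
      tendsto_fst[OF tendsto_snd[OF lim]] tendsto_snd[OF tendsto_snd[OF lim]]
    by (simp_all add: z l)
  define x where "x = \<i> *\<^sub>C d"
  have x: "(\<lambda>n. fst (z n)) \<longlonglongrightarrow> x"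
    using bounded_linear.tendsto[OF bounded_linear_scaleC[of \<i>] d] by (simp add: x_def)
  define y where "y = \<i> *\<^sub>C (c + r x)"
  have "(\<lambda>n. - (\<i> *\<^sub>C snd (z n))) \<longlonglongrightarrow> c + r x"
    using tendsto_add[OF c blinfun.tendsto[OF tendsto_const x, of r]] by simp
  from bounded_linear.tendsto[OF bounded_linear_scaleC[of \<i>] this]
  have y: "(\<lambda>n. snd (z n)) \<longlonglongrightarrow> y" by (simp add: y_def)
  have "a = C x" "b = C y"
    using LIMSEQ_unique[OF a blinfun.tendsto[OF tendsto_const x]]
      LIMSEQ_unique[OF b blinfun.tendsto[OF tendsto_const y]] by simp_all
  moreover have "c = - r x - \<i> *\<^sub>C y" "d = - (\<i> *\<^sub>C x)" by (simp_all add: x_def y_def)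
  ultimately show "l \<in> N_op C r" by (auto simp: l N_op_iff)
qed

lemma dense_Domain_N_op:
  assumes "closure (range C) = UNIV"
  shows "closure (Domain (N_op C r)) = UNIV"
proof -
  have "Domain (N_op C r) = range C \<times> range C"
    by (auto simp: Domain_iff N_op_iff, blast)
  then show ?thesis by (simp add: closure_Times assms)
qed

text \<open>The two coupling terms add up to a purely imaginary number by symmetry of
  \<open>C\<close>, which leaves the contribution of \<open>r\<close>.\<close>

lemma dissipative_N_op:
  assumes sym: "symmetric_op C" and acc: "\<And>x. Re (cinner (C x) (r x)) \<ge> 0"
    and "(p, q) \<in> N_op C r"
  shows "Re (cinner p q) \<le> 0"
proof -
  obtain x y where pq: "p = (C x, C y)" "q = (- r x - \<i> *\<^sub>C y, - (\<i> *\<^sub>C x))"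
    using assms(3) by (auto simp: N_op_def)
  have "cinner (C y) x = cnj (cinner (C x) y)"
    by (metis cinner_commute sym symmetric_opD)
  then have "Re (cinner p q) = - Re (cinner (C x) (r x))"
    by (simp add: pq cinner_Pair cinner.diff_right cinner.minus_right cinner_scaleC_right)
  with acc[of x] show ?thesis by simp
qed

text \<open>Eliminating \<open>x\<close> from \<open>(\<mu> - N)(C x, C y) = (p, q)\<close> leaves a fixed point equation for \<open>y\<close>
  with Lipschitz constant \<open>O(\<mu>)\<close>.\<close>

lemma range_condition_N_op: "\<exists>\<mu>>0. \<forall>w. \<exists>z. (z, \<mu> *\<^sub>R z - w) \<in> N_op C r"
proof -
  define M where "M = norm C + norm r + 1"
  have M: "norm C \<le> M" "norm C + norm r \<le> M" "M \<ge> 1" by (auto simp: M_def)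
  \<comment> \<open>Chosen so that composing maps with Lipschitz constants \<mu> M and M contracts
    by 1 / 2; M \<ge> 1 also yields \<mu> \<le> 1, used in \<open>Y_le\<close>.\<close>
  define \<mu> where "\<mu> = 1 / (2 * M\<^sup>2)"
  have "1 \<le> M\<^sup>2" using M(3) by (simp add: one_le_power)
  then have \<mu>: "\<mu> > 0" "\<mu> \<le> 1"
    using M(3) unfolding \<mu>_def by (simp, subst pos_divide_le_eq, simp, linarith)
  have "\<exists>z. (z, \<mu> *\<^sub>R z - (p, q)) \<in> N_op C r" for p q
  proof -
    define X where "X y = \<i> *\<^sub>C (\<mu> *\<^sub>R C y - q)" for y
    define Y where "Y x = \<i> *\<^sub>C (\<mu> *\<^sub>R C x - p + r x)" for x
    have X_le: "norm (X u - X v) \<le> \<mu> * M * norm (u - v)" for u v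
    proof -
      have "X u - X v = \<i> *\<^sub>C (\<mu> *\<^sub>R C (u - v))"
        by (simp add: X_def blinfun.diff_right scaleR_diff_right flip: scaleC_diff_right)
      then have "norm (X u - X v) = \<mu> * norm (C (u - v))" using \<mu> by (simp add: norm_scaleC)
      also have "\<dots> \<le> \<mu> * (M * norm (u - v))"
        using \<mu> M by (intro mult_left_mono order_trans[OF norm_blinfun] mult_right_mono) auto
      finally show ?thesis by simp
    qed
    have Y_le: "norm (Y u - Y v) \<le> M * norm (u - v)" for u v
    proof -
      have "Y u - Y v = \<i> *\<^sub>C (\<mu> *\<^sub>R C (u - v) + r (u - v))"
        by (simp add: Y_def blinfun.diff_right scaleR_diff_right algebra_simps flip: scaleC_diff_right)
      then have "norm (Y u - Y v) \<le> \<mu> * norm (C (u - v)) + norm (r (u - v))"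
        using \<mu> norm_triangle_ineq[of "\<mu> *\<^sub>R C (u - v)" "r (u - v)"] by (simp add: norm_scaleC)
      also have "\<dots> \<le> 1 * (norm C * norm (u - v)) + norm r * norm (u - v)"
        using \<mu> by (intro add_mono mult_mono norm_blinfun) auto
      also have "\<dots> \<le> M * norm (u - v)"
        using M(2) mult_right_mono[OF M(2), of "norm (u - v)"] by (simp add: algebra_simps)
      finally show ?thesis .
    qed
    have "\<exists>!y. Y (X y) = y"
    proof (rule banach_fix_type)
      show "\<forall>u v. dist (Y (X u)) (Y (X v)) \<le> 1 / 2 * dist u v"
      proof (intro allI)
        fix u v
        have "dist (Y (X u)) (Y (X v)) \<le> M * norm (X u - X v)" using Y_le by (simp add: dist_norm)
        also have "\<dots> \<le> M * (\<mu> * M * norm (u - v))" using M X_le by (intro mult_left_mono) auto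
        also have "\<dots> = 1 / 2 * dist u v"
          using M(3) by (simp add: \<mu>_def dist_norm power2_eq_square)
        finally show "dist (Y (X u)) (Y (X v)) \<le> 1 / 2 * dist u v" .
      qed
    qed auto
    then obtain y where y: "Y (X y) = y" by blast
    define x where "x = X y"
    have "\<i> *\<^sub>C y = - (\<mu> *\<^sub>R C x - p + r x)" by (subst y[symmetric]) (simp add: Y_def x_def)
    moreover have "\<i> *\<^sub>C x = - (\<mu> *\<^sub>R C y - q)" by (simp add: X_def x_def)
    ultimately have "\<mu> *\<^sub>R (C x, C y) - (p, q) = (- r x - \<i> *\<^sub>C y, - (\<i> *\<^sub>C x))"
      by simp
    then have "((C x, C y), \<mu> *\<^sub>R (C x, C y) - (p, q)) \<in> N_op C r" by (auto simp: N_op_iff)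
    then show ?thesis by blast
  qed
  with \<mu>(1) show ?thesis by (metis surj_pair)
qed

end

text \<open>R C is defined everywhere, and it inherits closability: a limit pair (0, y) of its
  graph, pushed through \<open>C\<close>, lies in a closed extension of \<open>R\<close>.\<close>

lemma relatively_bounded:
  fixes C :: "'a::chilbert_space \<Rightarrow>\<^sub>L 'a" and R :: "('a, 'a) graph"
  assumes "closable_op univ_space univ_space R" and "range C \<subseteq> Domain R"
    and linC: "\<And>c x. C (c *\<^sub>C x) = c *\<^sub>C C x"
  obtains r :: "'a \<Rightarrow>\<^sub>L 'a" where "\<And>x. (C x, r x) \<in> R" "\<And>c x. r (c *\<^sub>C x) = c *\<^sub>C r x"
proof -
  obtain S where R: "csubspace R" "single_valued R"
    and S: "csubspace S" "single_valued S" "closed S" "R \<subseteq> S"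
    using assms(1) by (auto simp: closable_op_def linear_op_univ_space closed_op_univ_space)
  let ?r = "\<lambda>x. app R (C x)"
  have r: "(C x, ?r x) \<in> R" for x using assms(2) by (intro app_mem[OF R(2)]) auto
  have r_scaleC: "?r (c *\<^sub>C x) = c *\<^sub>C ?r x" for c x
    unfolding linC by (intro app_eqI[OF R(2)] graph_scaleC[OF R(1)] r)
  have "linear ?r"
    by (rule linearI) (auto simp: blinfun.bilinear_simps
        intro!: app_eqI[OF R(2)] graph_add[OF R(1)] graph_scaleR[OF R(1)] r)
  then have bl: "bounded_linear ?r"
  proof (rule closable_everywhere_defined_bounded)
    fix x y assume x: "x \<longlonglongrightarrow> 0" and y: "(\<lambda>n. ?r (x n)) \<longlonglongrightarrow> y"
    have "(\<lambda>n. C (x n)) \<longlonglongrightarrow> C 0" by (intro blinfun.tendsto tendsto_const x)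
    then have "(\<lambda>n. (C (x n), ?r (x n))) \<longlonglongrightarrow> (0, y)"
      by (intro tendsto_Pair y) (simp add: blinfun.zero_right)
    then have "(0, y) \<in> S" by (rule closed_sequentially[OF S(3), rotated]) (use r S(4) in blast)
    then show "y = 0" using graph_zero[OF S(1)] S(2) single_valuedD by fastforce
  qed
  show thesis
    using r r_scaleC by (intro that[of "Blinfun ?r"]) (simp_all add: bounded_linear_Blinfun_apply[OF bl])
qed

lemma mk_op_cong: "(\<And>x. x \<in> D \<Longrightarrow> F x = G x) \<Longrightarrow> mk_op D F = mk_op D G"
  by (auto simp: mk_op_def)

context coercive_closed_operator
begin

section \<open>Identification of the operator matrices with the model\<close>

lemma hnorm_H_of_sum:
  "hnorm (H_of A \<oplus>\<^sub>h univ_space) (f, g) = sqrt ((norm (app A f))\<^sup>2 + (norm (g :: 'a))\<^sup>2)"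
  by (simp add: hnorm_def sum_space_def H_of_def univ_space_def Re_cinner_self)

text \<open>Off the domain, \<^const>\<open>app\<close> is the description of an empty predicate.\<close>

lemma norm_app_minus: "norm (app A (- f)) = norm (app A f)"
proof (cases "f \<in> Domain A")
  case True
  then have "(- f, - app A f) \<in> A"
    using graph_scaleC[OF subspace_A app_mem[OF sv_A True], of "- 1"] by simp
  then show ?thesis using app_eqI[OF sv_A] by (metis norm_minus_cancel)
next
  case False
  then have "- f \<notin> Domain A"
    using csubspace_scaleC[OF csubspace_Domain[OF subspace_A], of "- f" "- 1"] by auto
  with False have "(\<lambda>y. (f, y) \<in> A) = (\<lambda>y. (- f, y) \<in> A)" by blast
  then show ?thesis by (simp add: app_def)
qed

lemma hcarrier_H_of_sum:
  "hcarrier (H_of A \<oplus>\<^sub>h (univ_space :: 'a inner_space)) = Domain A \<times> UNIV"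
  by (simp add: sum_space_def H_of_def univ_space_def)

lemma U_op_eq_mk_op:
  "U_op A = mk_op (Domain A \<times> UNIV) (\<lambda>(f, g). (g, - (\<i> *\<^sub>C app (op_abs A) f)))"
proof -
  have "app (tilde_abs A) f = app (op_abs A) f" if "f \<in> Domain A" for f
    using that by (simp add: tilde_abs_def H_of_def)
  then show ?thesis
    unfolding U_op_def hcarrier_H_of_sum by (intro mk_op_cong) (elim SigmaE, simp)
qed

text \<open>\<open>tilde_op A\<close> has the same graph as \<open>A\<close>; only the scalar
  product on the source differs, and composition does not see it.\<close>

lemma tilde_comp_eq: "adjoint_op A \<odot> tilde_op A = T"
proof -
  have "tilde_op A = A"
    using app_eqI[OF sv_A] app_mem[OF sv_A] by (auto simp: tilde_op_def mk_op_def H_of_def)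
  then show ?thesis by simp
qed

context
  fixes C r :: "'a \<Rightarrow>\<^sub>L 'a" and R :: "('a, 'a) graph"
  assumes abs_A: "op_abs A = range (\<lambda>x. (C x, x))" and T_eq: "T = range (\<lambda>x. (C (C x), x))"
    and injC: "inj C" and symC: "symmetric_op C" and linC: "\<And>c x. C (c *\<^sub>C x) = c *\<^sub>C C x"
    and dom_A: "Domain A = range C"
    and isoC: "\<And>x y. cinner (app A (C x)) (app A (C y)) = cinner x y"
    and sv_R: "single_valued R" and r: "\<And>x. (C x, r x) \<in> R"
    and linr: "\<And>c x. r (c *\<^sub>C x) = c *\<^sub>C r x"
begin

lemma app_abs: "app (op_abs A) (C x) = x"
  unfolding abs_A using injC by (intro app_eqI) (auto simp: single_valued_def dest: injD)

lemma app_R: "app R (C x) = r x"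
  by (rule app_eqI[OF sv_R r])

lemma Q_op_eq:
  "Q_op (op_abs A) R = range (\<lambda>(x, y). ((C x, C y), (- (\<i> *\<^sub>C r x) + y, x)))"
proof -
  have "Domain (op_abs A) = range C" unfolding abs_A by auto
  then show ?thesis by (force simp: Q_op_def mk_op_def app_abs app_R)
qed

lemma G_op_eq: "G_op A R = range (\<lambda>(x, y). ((C (C x), C y), (C y, - x - r y)))"
proof -
  have "Domain T = range (\<lambda>x. C (C x))" unfolding T_eq by auto
  moreover have "app T (C (C x)) = x" for x
    by (rule app_eqI[OF single_valued_T]) (auto simp: T_eq)
  moreover have "app (J_op A) (C y) = C y" for y by (simp add: J_op_def dom_A)
  ultimately show ?thesis
    unfolding G_op_def tilde_comp_eq dom_A by (force simp: mk_op_def app_R)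
qed

lemma U_op_eq: "U_op A = range (\<lambda>(x, g). ((C x, g), (g, - (\<i> *\<^sub>C x))))"
  unfolding U_op_eq_mk_op dom_A by (force simp: mk_op_def app_abs)

text \<open>In the graph chase, equations between values of \<open>C\<close> are cancelled by
  injectivity. The domains agree because the requirement that the first entry lie in dom T = ran (C
  C) is what puts \<open>g\<close> into ran C.\<close>

lemma Q_op_unitarily_equivalent: "Q_op (op_abs A) R = U_op A \<odot> op_scale \<i> (G_op A R) \<odot> (U_op A)\<inverse>"
proof -
  have "((f, g), (p, q)) \<in> U_op A \<odot> op_scale \<i> (G_op A R) \<odot> (U_op A)\<inverse>
      \<longleftrightarrow> (\<exists>x y. f = C x \<and> g = C y \<and> p = - (\<i> *\<^sub>C r x) + y \<and> q = x)" (is "?lhs \<longleftrightarrow> ?rhs") for f g p q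
  proof
    assume ?lhs
    then obtain s u where s: "(s, (f, g)) \<in> U_op A" and su: "(s, u) \<in> op_scale \<i> (G_op A R)"
      and u: "(u, (p, q)) \<in> U_op A"
      unfolding op_comp_iff by blast
    obtain x h where xh: "f = h" "g = - (\<i> *\<^sub>C x)" and "s = (C x, h)"
      using s by (auto simp: U_op_eq)
    then obtain y z where "C x = C (C y)" "h = C z" and u_eq: "u = \<i> *\<^sub>C (C z, - y - r z)"
      using su by (auto simp: op_scale_def G_op_eq)
    then have "x = C y" using injD[OF injC] by blast
    obtain v w where vw: "u = (C v, w)" "p = w" "q = - (\<i> *\<^sub>C v)" using u by (auto simp: U_op_eq)
    then have "C v = C (\<i> *\<^sub>C z)" using u_eq by (simp add: scaleC_Pair linC)
    then have "v = \<i> *\<^sub>C z" using injD[OF injC] by blast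
    have "p = - (\<i> *\<^sub>C y) - \<i> *\<^sub>C r z" using vw u_eq by (simp add: scaleC_Pair scaleC_diff_right)
    then show ?rhs
      using xh vw \<open>h = C z\<close> \<open>x = C y\<close> \<open>v = \<i> *\<^sub>C z\<close>
      by (intro exI[of _ z] exI[of _ "- (\<i> *\<^sub>C y)"]) (simp add: linC blinfun.minus_right)
  next
    assume ?rhs
    then obtain y where y: "f = C q" "g = C y" "p = - (\<i> *\<^sub>C r q) + y" by blast
    \<comment> \<open>From g = C y, the first entry of the preimage under U is C applied to i g,
      that is C (C (i y)).\<close>
    let ?x = "\<i> *\<^sub>C y"
    have "((C (C ?x), f), (f, g)) \<in> U_op A"
      unfolding U_op_eq by (rule range_eqI[of _ _ "(C ?x, f)"]) (simp add: y linC)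
    moreover have "((C (C ?x), f), (\<i> *\<^sub>C f, p)) \<in> op_scale \<i> (G_op A R)"
    proof -
      have "((C (C ?x), f), (f, - ?x - r q)) \<in> G_op A R"
        unfolding G_op_eq y by (rule range_eqI[of _ _ "(?x, q)"]) simp
      moreover have "(\<i> *\<^sub>C f, p) = \<i> *\<^sub>C (f, - ?x - r q)"
        by (simp add: scaleC_Pair scaleC_diff_right y)
      ultimately show ?thesis unfolding op_scale_def by blast
    qed
    moreover have "((\<i> *\<^sub>C f, p), (p, q)) \<in> U_op A"
      unfolding U_op_eq by (rule range_eqI[of _ _ "(\<i> *\<^sub>C q, p)"]) (simp add: y linC)
    ultimately show ?lhs unfolding op_comp_iff by blast
  qed
  moreover have "((f, g), (p, q)) \<in> Q_op (op_abs A) R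
      \<longleftrightarrow> (\<exists>x y. f = C x \<and> g = C y \<and> p = - (\<i> *\<^sub>C r x) + y \<and> q = x)" for f g p q
    by (simp add: Q_op_eq image_iff)
  ultimately show ?thesis by (simp only: set_eq_iff split_paired_All) blast
qed

text \<open>The map U and its inverse as functions; \<open>isoC\<close> is what makes it preserve
  scalar products.\<close>

interpretation unitary_map "H_of A \<oplus>\<^sub>h (univ_space :: 'a inner_space)"
  "\<lambda>(f, g). (g, - (\<i> *\<^sub>C app (op_abs A) f))" "\<lambda>(u, v). (C (\<i> *\<^sub>C v), u)"
proof
  show "csubspace (hcarrier (H_of A \<oplus>\<^sub>h (univ_space :: 'a inner_space)))"
    using csubspace_Domain[OF subspace_A]
    by (auto simp: hcarrier_H_of_sum csubspace_iff scaleC_Pair zero_prod_def)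
  fix x :: "'a \<times> 'a"
  show "hnorm (H_of A \<oplus>\<^sub>h univ_space) x \<ge> 0"
    "hnorm (H_of A \<oplus>\<^sub>h univ_space) (- x) = hnorm (H_of A \<oplus>\<^sub>h univ_space) x"
    by (cases x, simp add: hnorm_H_of_sum norm_app_minus)+
qed (auto simp: sum_space_def H_of_def univ_space_def dom_A app_abs cinner_Pair isoC scaleC_Pair
    cinner.minus_left cinner.minus_right cinner_scaleC_left cinner_scaleC_right scaleC_add_right scaleC_scaleC mult.commute simp flip: blinfun.add_right linC)

lemma pull_iff:
  "((f, g), (p, q)) \<in> pull N \<longleftrightarrow> f \<in> range C \<and> p \<in> range C
    \<and> ((g, - (\<i> *\<^sub>C app (op_abs A) f)), (q, - (\<i> *\<^sub>C app (op_abs A) p))) \<in> N"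
  by (simp add: pull_def hcarrier_H_of_sum dom_A)

text \<open>Pulling back requires f in ran C only, but the domain of the model also asks that |A| f
  lie in ran C. Together these give f in ran (C C) = dom T, the domain condition of
  \<open>G_op\<close>.\<close>

lemma G_op_eq_pull: "G_op A R = pull (N_op C r)"
proof -
  have "((f, g), (p, q)) \<in> G_op A R \<longleftrightarrow> ((f, g), (p, q)) \<in> pull (N_op C r)" for f g p q
  proof
    assume "((f, g), (p, q)) \<in> G_op A R"
    then obtain x y where xy: "f = C (C x)" "g = C y" "p = C y" "q = - x - r y"
      by (auto simp: G_op_eq)
    have "((g, - (\<i> *\<^sub>C C x)), (q, - (\<i> *\<^sub>C y))) \<in> N_op C r"
      unfolding N_op_iff
    proof (intro exI conjI)
      show "g = C y" "- (\<i> *\<^sub>C C x) = C (- (\<i> *\<^sub>C x))" "q = - r y - \<i> *\<^sub>C - (\<i> *\<^sub>C x)"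
        by (simp_all add: xy linC blinfun.minus_right)
    qed simp
    with xy show "((f, g), (p, q)) \<in> pull (N_op C r)" by (simp add: pull_iff app_abs)
  next
    assume "((f, g), (p, q)) \<in> pull (N_op C r)"
    then obtain a b where ab: "f = C a" "p = C b"
      and "((g, - (\<i> *\<^sub>C a)), (q, - (\<i> *\<^sub>C b))) \<in> N_op C r"
      by (auto simp: pull_iff app_abs)
    then obtain x y where xy: "g = C x" "- (\<i> *\<^sub>C a) = C y" "q = - r x - \<i> *\<^sub>C y"
      "- (\<i> *\<^sub>C b) = - (\<i> *\<^sub>C x)"
      by (auto simp: N_op_iff)
    have "a = C (\<i> *\<^sub>C y)"
      using arg_cong[OF xy(2), of "\<lambda>z. \<i> *\<^sub>C z"] by (simp add: linC)
    moreover have "b = x"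
      using arg_cong[OF xy(4), of "\<lambda>z. \<i> *\<^sub>C z"] by simp
    ultimately show "((f, g), (p, q)) \<in> G_op A R"
      unfolding G_op_eq using ab xy by (intro range_eqI[of _ _ "(\<i> *\<^sub>C y, x)"]) simp
  qed
  then show ?thesis by auto
qed

lemma G_op_properties:
  assumes dense: "closure (range C) = UNIV"
  shows "densely_defined (H_of A \<oplus>\<^sub>h univ_space) (G_op A R)"
    and "closed_op (H_of A \<oplus>\<^sub>h univ_space) (H_of A \<oplus>\<^sub>h univ_space) (G_op A R)"
    and "accretive univ_space R \<Longrightarrow>
      accretive (H_of A \<oplus>\<^sub>h univ_space) (op_scale (-1) (G_op A R))"
    and "accretive univ_space R \<Longrightarrow>
      generates_contraction_semigroup (H_of A \<oplus>\<^sub>h univ_space) (G_op A R)"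
proof -
  note N = csubspace_N_op[OF injC linC linr] single_valued_N_op[OF injC linC linr]
    closed_N_op[OF injC linC linr] dense_Domain_N_op[OF injC linC linr dense]
  show "densely_defined (H_of A \<oplus>\<^sub>h univ_space) (G_op A R)"
    unfolding G_op_eq_pull by (rule densely_defined_pull[OF N(4)])
  show "closed_op (H_of A \<oplus>\<^sub>h univ_space) (H_of A \<oplus>\<^sub>h univ_space) (G_op A R)"
    unfolding G_op_eq_pull by (rule closed_op_pull[OF N(1-3)])
  assume "accretive univ_space R"
  then have "Re (cinner (C x) (r x)) \<ge> 0" for x
    using r[of x] by (auto simp: accretive_def univ_space_def)
  note dissipative = dissipative_N_op[OF injC linC linr symC this]
  show "accretive (H_of A \<oplus>\<^sub>h univ_space) (op_scale (-1) (G_op A R))"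
    unfolding G_op_eq_pull by (rule accretive_minus_pull[OF dissipative])
  have "maximal_dissipative (N_op C r)"
    by unfold_locales (rule N dissipative range_condition_N_op[OF injC linC linr]; assumption)+
  then show "generates_contraction_semigroup (H_of A \<oplus>\<^sub>h univ_space) (G_op A R)"
    unfolding G_op_eq_pull
    by (intro generates_contraction_semigroup_pull maximal_dissipative.generates_contraction_semigroup)
qed

end

end

theorem theorem4p4:
  fixes A :: "('a::chilbert_space, 'b::chilbert_space) graph"
    and R :: "('a, 'a) graph"
    and \<epsilon> :: real
  assumes "separable_space (euclidean :: 'a topology)"
    and "separable_space (euclidean :: 'b topology)"
    and "densely_defined univ_space A"
    and "closed_op univ_space univ_space A"
    and "\<epsilon> > 0"
    and "op_geq (adjoint_op A \<odot> A) \<epsilon>"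
    and "densely_defined univ_space R"
    and "closable_op univ_space univ_space R"
    and "Domain A \<subseteq> Domain R"
  shows "Q_op (op_abs A) R = U_op A \<odot> op_scale \<i> (G_op A R) \<odot> (U_op A)\<inverse>
    \<and> densely_defined (H_of A \<oplus>\<^sub>h univ_space) (G_op A R)
    \<and> closed_op (H_of A \<oplus>\<^sub>h univ_space) (H_of A \<oplus>\<^sub>h univ_space) (G_op A R)
    \<and> (accretive univ_space R \<longrightarrow>
        accretive (H_of A \<oplus>\<^sub>h univ_space) (op_scale (-1) (G_op A R))
        \<and> generates_contraction_semigroup (H_of A \<oplus>\<^sub>h univ_space) (G_op A R))"
proof -
  interpret coercive_closed_operator A \<epsilon>
    using assms(3-6) by unfold_locales (simp_all add: closed_op_univ_space densely_defined_univ_space)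
  obtain C :: "'a \<Rightarrow>\<^sub>L 'a" where C: "op_abs A = range (\<lambda>x. (C x, x))"
    "T = range (\<lambda>x. (C (C x), x))" "inj C" "symmetric_op C" "\<And>c x. C (c *\<^sub>C x) = c *\<^sub>C C x"
    "closure (range C) = UNIV" "Domain A = range C"
    "\<And>x y. cinner (app A (C x)) (app A (C y)) = cinner x y"
    by (rule op_abs_structure, rule that) (assumption | blast)+
  obtain r :: "'a \<Rightarrow>\<^sub>L 'a" where r: "\<And>x. (C x, r x) \<in> R" "\<And>c x. r (c *\<^sub>C x) = c *\<^sub>C r x"
    using relatively_bounded[OF assms(8), of C] C(5,7) assms(9) by metis
  have "single_valued R" using assms(8) by (simp add: closable_op_def linear_op_univ_space)
  note setting = C(1-5,7,8) this r
  show ?thesis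
    using Q_op_unitarily_equivalent[OF setting] G_op_properties[OF setting C(6)] by blast
qed

end
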